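(* Let $k\ge 1$, let $d_1,\dots,d_k$ be positive integers and let $r\ge 0$ be an integer. The set $$\mathcal{R}_r(d_1,\dots,d_k):=\{A\in\mathbb{R}^{d_1\times\dots\times d_k}\mid\operatorname{rank}_\otimes(A)=r\}$$ is a semialgebraic set.
   Context: $\mathbb{R}^{d_1\times\dots\times d_k}\cong\mathbb{R}^{d_1}\otimes\dots\otimes\mathbb{R}^{d_k}$ is the space of real $k$-way arrays; $\mathbf{x}_1\otimes\dots\otimes\mathbf{x}_k$ is the array with entries $x^{(1)}_{j_1}\cdots x^{(k)}_{j_k}$ (a decomposable tensor). The outer-product rank $\operatorname{rank}_{\otimes}(A)$ is the least $r\ge 0$ such that $A$ is a sum of $r$ decomposable tensors. A semialgebraic set in $\mathbb{R}^n$ is a finite union of sets of the form $\{\mathbf{a}\in\mathbb{R}^n\mid p(\mathbf{a})=0,\ q_1(\mathbf{a})>0,\dots,q_\ell(\mathbf{a})>0\}$ with $p,q_1,\dots,q_\ell\in\mathbb{R}[X_1,\dots,X_n]$ (constant polynomials allowed). *)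

theory Defs
  imports Complex_Main "HOL-Library.FuncSet" "HOL-Library.Poly_Mapping"
begin

section \<open>Semialgebraic sets\<close>

text \<open>
  A real polynomial in the variables \<open>X\<^sub>i\<close> is a finitely supported map from monomials to
  coefficients, and a monomial is a finitely supported map from variables to exponents.
  For a finite index set \<open>I\<close>, the space \<open>\<real>\<^sup>n\<close> with \<open>n = card I\<close> is \<open>I \<rightarrow>\<^sub>E UNIV\<close>, the
  functions that are \<open>undefined\<close> outside \<open>I\<close>.
\<close>

type_synonym 'i real_mpoly = "('i \<Rightarrow>\<^sub>0 nat) \<Rightarrow>\<^sub>0 real"

definition polys_in :: "'i set \<Rightarrow> 'i real_mpoly set" where
  "polys_in I = {p. \<forall>m\<in>Poly_Mapping.keys p. Poly_Mapping.keys m \<subseteq> I}"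

definition mpoly_eval :: "'i real_mpoly \<Rightarrow> ('i \<Rightarrow> real) \<Rightarrow> real" where
  "mpoly_eval p a =
     (\<Sum>m\<in>Poly_Mapping.keys p. Poly_Mapping.lookup p m *
        (\<Prod>i\<in>Poly_Mapping.keys m. a i ^ Poly_Mapping.lookup m i))"

definition basic_semialgebraic :: "'i set \<Rightarrow> ('i \<Rightarrow> real) set \<Rightarrow> bool" where
  "basic_semialgebraic I S \<longleftrightarrow>
     (\<exists>p Q. p \<in> polys_in I \<and> finite Q \<and> Q \<subseteq> polys_in I \<and>
        S = {a \<in> I \<rightarrow>\<^sub>E UNIV. mpoly_eval p a = 0 \<and> (\<forall>q\<in>Q. mpoly_eval q a > 0)})"

definition semialgebraic :: "'i set \<Rightarrow> ('i \<Rightarrow> real) set \<Rightarrow> bool" where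
  "semialgebraic I S \<longleftrightarrow>
     (\<exists>F. finite F \<and> (\<forall>B\<in>F. basic_semialgebraic I B) \<and> S = \<Union>F)"

section \<open>Arrays and outer-product rank\<close>

text \<open>
  The factors are numbered \<open>0, \<dots>, k - 1\<close>, and the \<open>i\<close>-th index of an array ranges over
  \<open>0, \<dots>, d i - 1\<close>. The values \<open>d i\<close> for \<open>i \<ge> k\<close> play no role.
\<close>

definition multi_index :: "nat \<Rightarrow> (nat \<Rightarrow> nat) \<Rightarrow> (nat \<Rightarrow> nat) set" where
  "multi_index k d = (\<Pi>\<^sub>E i\<in>{..<k}. {..<d i})"

definition arrays :: "nat \<Rightarrow> (nat \<Rightarrow> nat) \<Rightarrow> ((nat \<Rightarrow> nat) \<Rightarrow> real) set" where
  "arrays k d = multi_index k d \<rightarrow>\<^sub>E UNIV"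

text \<open>
  Only the entries \<open>x i j\<close> with \<open>i < k\<close> and \<open>j < d i\<close> matter, so \<open>x\<close> represents a tuple of
  vectors of lengths \<open>d 0, \<dots>, d (k - 1)\<close>.
\<close>

definition outer_product ::
    "nat \<Rightarrow> (nat \<Rightarrow> nat) \<Rightarrow> (nat \<Rightarrow> nat \<Rightarrow> real) \<Rightarrow> (nat \<Rightarrow> nat) \<Rightarrow> real" where
  "outer_product k d x = (\<lambda>j\<in>multi_index k d. \<Prod>i<k. x i (j i))"

definition decomposable ::
    "nat \<Rightarrow> (nat \<Rightarrow> nat) \<Rightarrow> ((nat \<Rightarrow> nat) \<Rightarrow> real) \<Rightarrow> bool" where
  "decomposable k d A \<longleftrightarrow> (\<exists>x. A = outer_product k d x)"

text \<open>
  The rank is only meaningful for elements of \<open>arrays k d\<close>. Sums of arrays are taken entrywise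
  on \<open>multi_index k d\<close>, keeping the value \<open>undefined\<close> elsewhere; the empty sum is the zero array.
\<close>

definition outer_rank :: "nat \<Rightarrow> (nat \<Rightarrow> nat) \<Rightarrow> ((nat \<Rightarrow> nat) \<Rightarrow> real) \<Rightarrow> nat" where
  "outer_rank k d A =
     (LEAST r. \<exists>T :: nat \<Rightarrow> (nat \<Rightarrow> nat) \<Rightarrow> real.
        (\<forall>s<r. decomposable k d (T s)) \<and> A = (\<lambda>j\<in>multi_index k d. \<Sum>s<r. T s j))"

end

theory Submission
  imports Defs "HOL-Computational_Algebra.Polynomial" "HOL-Library.Multiset_Order"
begin

text \<open>
  The arrays of rank at most \<open>r\<close> form a projection of a real algebraic set, so the matter is the
  Tarski-Seidenberg theorem. Elimination of one variable follows Cohen and Hoermander, with order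
  automorphisms of \<open>\<real>\<close> in place of sign tables: two parameter values are equivalent for a finite
  family of univariate polynomials if such an automorphism carries the signs of the family at one
  value to those at the other. Where leading coefficients have constant sign, the equivalence for
  a family with a member \<open>p\<close> of maximal degree follows from that for the family in which \<open>p\<close> is
  replaced by its derivative and its remainders modulo the other members and the derivative, since
  between consecutive zeros of these \<open>p\<close> is monotone with matched signs at the ends. By induction
  on the multiset of degrees, finitely many semialgebraic sets of pairwise equivalent parameters
  cover the parameter space, and the truth of an existential statement is constant on each.
\<close>

section \<open>Order automorphisms of the real line\<close>

text \<open>The notion of equivalence is purely order-theoretic: the automorphisms need not be
  differentiable, and one map carries all signs at all points, so zeros are never enumerated. The
  difficulty is to repair an automorphism for a new polynomial without spoiling it for the old ones.
  The repair is a composition with a map that shifts points only inside the cells cut out by the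
  zeros of the old family and two far points; inside a cell no old sign can change. As the
  derivative belongs to the old family, each cell holds at most one zero of the new polynomial, and
  a repair amounts to moving one point per cell. Remainders serve to know the sign of the new
  polynomial at the zeros of the others. The degree of a member varies with the parameter, so each
  member carries a formal length, and the induction runs on these lengths. Where a leading slot
  vanishes, the member is truncated instead. Assignments of coordinates are total functions until
  the very end, so that a single coordinate can be updated freely.\<close>

definition order_auto :: "(real \<Rightarrow> real) \<Rightarrow> bool" where
  "order_auto \<phi> \<longleftrightarrow> strict_mono \<phi> \<and> surj \<phi>"

lemma order_auto_less_iff: "order_auto \<phi> \<Longrightarrow> \<phi> s < \<phi> t \<longleftrightarrow> s < t"
  by (simp add: order_auto_def strict_mono_less)

lemma order_auto_le_iff: "order_auto \<phi> \<Longrightarrow> \<phi> s \<le> \<phi> t \<longleftrightarrow> s \<le> t"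
  by (simp add: order_auto_def strict_mono_less_eq)

lemma order_auto_surjE:
  assumes "order_auto \<phi>"
  obtains s where "t = \<phi> s"
  using assms unfolding order_auto_def by (metis surjD)

lemma order_auto_id: "order_auto (\<lambda>t. t)"
  by (simp add: order_auto_def strict_mono_def)

lemma order_auto_comp:
  assumes "order_auto \<phi>" "order_auto \<psi>"
  shows "order_auto (\<lambda>t. \<phi> (\<psi> t))"
  using assms comp_surj[of \<psi> \<phi>] by (auto simp: order_auto_def strict_mono_def comp_def)

lemma order_auto_inv:
  assumes "order_auto \<phi>"
  shows "order_auto (inv \<phi>)"
proof -
  have b: "inj \<phi>" "surj \<phi>"
    using assms strict_mono_imp_inj_on by (auto simp: order_auto_def)
  then have "surj (inv \<phi>)"
    by (simp add: inj_imp_surj_inv)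
  moreover have "strict_mono (inv \<phi>)"
    using order_auto_less_iff[OF assms] b(2) by (metis strict_monoI surj_f_inv_f)
  ultimately show ?thesis
    by (simp add: order_auto_def)
qed

lemma order_auto_continuous:
  assumes "order_auto \<phi>"
  shows "continuous_on UNIV \<phi>"
  using assms by (intro continuous_onI_mono) (auto simp: order_auto_def strict_mono_less_eq)

lemma order_auto_affine:
  assumes "a > 0"
  shows "order_auto (\<lambda>t. a * t + b)"
proof -
  have "\<exists>s. t = a * s + b" for t
    using assms by (intro exI[of _ "(t - b) / a"]) simp
  then show ?thesis
    using assms by (auto simp: order_auto_def strict_mono_def surj_def)
qed

text \<open>Closure under max and min turns affine automorphisms into piecewise affine ones. A value
  is attained at the smaller of its two preimages, where the other map does not exceed it.\<close>

lemma order_auto_max: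
  assumes "order_auto \<phi>" "order_auto \<psi>"
  shows "order_auto (\<lambda>t. max (\<phi> t) (\<psi> t))"
proof -
  have "\<exists>s. t = max (\<phi> s) (\<psi> s)" for t
  proof -
    obtain s1 s2 where s: "t = \<phi> s1" "t = \<psi> s2"
      using order_auto_surjE assms by metis
    show ?thesis
    proof (cases "s1 \<le> s2")
      case True
      then show ?thesis
        using s assms by (intro exI[of _ s1]) (metis max.absorb1 order_auto_le_iff)
    next
      case False
      then show ?thesis
        using s assms by (intro exI[of _ s2]) (metis max.absorb2 nle_le order_auto_le_iff)
    qed
  qed
  moreover have "max (\<phi> s) (\<psi> s) < max (\<phi> t) (\<psi> t)" if "s < t" for s t
    using that assms[THEN order_auto_less_iff, of s t] by (auto simp: max_def)
  ultimately show ?thesis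
    unfolding order_auto_def strict_mono_def surj_def by blast
qed

lemma order_auto_min:
  assumes "order_auto \<phi>" "order_auto \<psi>"
  shows "order_auto (\<lambda>t. min (\<phi> t) (\<psi> t))"
proof -
  have "\<exists>s. t = min (\<phi> s) (\<psi> s)" for t
  proof -
    obtain s1 s2 where s: "t = \<phi> s1" "t = \<psi> s2"
      using order_auto_surjE assms by metis
    show ?thesis
    proof (cases "s1 \<le> s2")
      case True
      then show ?thesis
        using s assms by (intro exI[of _ s2]) (metis min.absorb2 order_auto_le_iff)
    next
      case False
      then show ?thesis
        using s assms by (intro exI[of _ s1]) (metis min.absorb1 nle_le order_auto_le_iff)
    qed
  qed
  moreover have "min (\<phi> s) (\<psi> s) < min (\<phi> t) (\<psi> t)" if "s < t" for s t
    using that assms[THEN order_auto_less_iff, of s t] by (auto simp: min_def)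
  ultimately show ?thesis
    unfolding order_auto_def strict_mono_def surj_def by blast
qed

section \<open>Moving points by automorphisms\<close>

lemma order_auto_move_up:
  assumes "u < a" "a \<le> b" "b < v"
  obtains \<mu> where "order_auto \<mu>" "\<mu> a = b" "\<And>t. t \<le> u \<or> v \<le> t \<Longrightarrow> \<mu> t = t"
proof -
  \<comment> \<open>The chords from \<open>(u, u)\<close> to \<open>(a, b)\<close> and from \<open>(a, b)\<close> to \<open>(v, v)\<close> bound a concave bump
    above the diagonal.\<close>
  define k1 where "k1 = (b - u) / (a - u)"
  define k2 where "k2 = (v - b) / (v - a)"
  define l1 where "l1 = (\<lambda>t. k1 * t + (u - k1 * u))"
  define l2 where "l2 = (\<lambda>t. k2 * t + (v - k2 * v))"
  have k: "k1 \<ge> 1" "0 < k2" "k2 \<le> 1"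
    using assms by (auto simp: k1_def k2_def field_simps)
  have l: "l1 t - t = (k1 - 1) * (t - u)" "l2 t - t = (1 - k2) * (v - t)" for t
    by (auto simp: l1_def l2_def algebra_simps)
  have "k1 * (a - u) = b - u" "k2 * (v - a) = v - b"
    using assms by (auto simp: k1_def k2_def)
  then have la: "l1 a = b" "l2 a = b"
    by (auto simp: l1_def l2_def algebra_simps)
  have "order_auto l1" "order_auto l2"
    using k unfolding l1_def l2_def by (auto intro!: order_auto_affine)
  then have "order_auto (\<lambda>t. max t (min (l1 t) (l2 t)))"
    by (intro order_auto_max order_auto_min order_auto_id)
  moreover have "max a (min (l1 a) (l2 a)) = b"
    using la assms by simp
  moreover have "max t (min (l1 t) (l2 t)) = t" if "t \<le> u \<or> v \<le> t" for t
  proof -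
    have "l1 t - t \<le> 0 \<or> l2 t - t \<le> 0"
      unfolding l using that k by (auto intro: mult_nonneg_nonpos)
    then show ?thesis
      by linarith
  qed
  ultimately show thesis
    by (rule that)
qed

lemma order_auto_move:
  assumes "u < a" "a < v" "u < b" "b < v"
  obtains \<mu> where "order_auto \<mu>" "\<mu> a = b" "\<And>t. t \<le> u \<or> v \<le> t \<Longrightarrow> \<mu> t = t"
proof (cases "a \<le> b")
  case True
  then show thesis
    using order_auto_move_up[of u a b v] assms that by blast
next
  case False
  then obtain \<mu> where \<mu>: "order_auto \<mu>" "\<mu> b = a" "\<And>t. t \<le> u \<or> v \<le> t \<Longrightarrow> \<mu> t = t"
    using order_auto_move_up[of u b a v] assms by (metis less_imp_le not_le)
  have "inj \<mu>"
    using \<mu>(1) by (simp add: order_auto_def strict_mono_imp_inj_on)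
  then have "inv \<mu> a = b" "\<And>t. t \<le> u \<or> v \<le> t \<Longrightarrow> inv \<mu> t = t"
    using \<mu> by (metis inv_f_f)+
  then show thesis
    using that order_auto_inv[OF \<mu>(1)] by blast
qed

text \<open>For points off \<open>C\<close>, this says that they lie in the same component of the complement of \<open>C\<close>.\<close>

definition same_cell :: "real set \<Rightarrow> real \<Rightarrow> real \<Rightarrow> bool" where
  "same_cell C s t \<longleftrightarrow> (\<forall>c\<in>C. sgn (s - c) = sgn (t - c))"

lemma same_cell_refl [simp]: "same_cell C t t"
  by (simp add: same_cell_def)

lemma same_cell_sym: "same_cell C s t \<Longrightarrow> same_cell C t s"
  by (simp add: same_cell_def)

lemma same_cell_trans: "same_cell C s t \<Longrightarrow> same_cell C t u \<Longrightarrow> same_cell C s u"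
  by (simp add: same_cell_def)

lemma sgn_eq_iff: "sgn x = sgn y \<longleftrightarrow> (x < 0 \<longleftrightarrow> y < 0) \<and> (0 < x \<longleftrightarrow> 0 < y)" for x y :: real
  by (auto simp: sgn_if)

lemma same_cell_iff:
  "same_cell C s t \<longleftrightarrow> (\<forall>c\<in>C. (s < c \<longleftrightarrow> t < c) \<and> (c < s \<longleftrightarrow> c < t))"
  by (simp add: same_cell_def sgn_eq_iff)

text \<open>The sign of \<open>s - s\<close> is 0, so a point of \<open>C\<close> is a cell by
  itself. An automorphism that respects cells therefore fixes \<open>C\<close> pointwise.\<close>

lemma same_cell_fixed:
  assumes "same_cell C s t" "s \<in> C"
  shows "s = t"
proof -
  have "(s < s \<longleftrightarrow> t < s) \<and> (s < s \<longleftrightarrow> s < t)"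
    using assms unfolding same_cell_iff by blast
  then show ?thesis
    by simp
qed

lemma same_cell_notin: "same_cell C s t \<Longrightarrow> t \<notin> C \<Longrightarrow> s \<notin> C"
  using same_cell_fixed by blast

lemma same_cell_between:
  assumes "same_cell C s t" "s \<le> u" "u \<le> t"
  shows "same_cell C u s"
  unfolding same_cell_iff
proof (intro ballI)
  fix c assume "c \<in> C"
  then have "(s < c \<longleftrightarrow> t < c) \<and> (c < s \<longleftrightarrow> c < t)"
    using assms(1) unfolding same_cell_iff by blast
  then show "(u < c) = (s < c) \<and> (c < u) = (c < s)"
    using assms(2,3) by linarith
qed

lemma not_same_cellE:
  assumes "\<not> same_cell C s t" "s < t" "s \<notin> C" "t \<notin> C"
  obtains c where "c \<in> C" "s < c" "c < t"
proof -
  obtain c where c: "c \<in> C" "\<not> ((s < c \<longleftrightarrow> t < c) \<and> (c < s \<longleftrightarrow> c < t))"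
    using assms(1) unfolding same_cell_iff by blast
  then have "c \<noteq> s" "c \<noteq> t"
    using assms(3,4) by auto
  then have "s < c" "c < t"
    using c(2) assms(2) by linarith+
  then show thesis
    using that c(1) by blast
qed

lemma order_auto_move_cell:
  assumes "finite C" "a \<notin> C" "same_cell C a b"
  obtains \<mu> where "order_auto \<mu>" "\<mu> a = b" "\<And>t. same_cell C (\<mu> t) t"
    "\<And>t. t \<notin> C \<Longrightarrow> \<not> same_cell C a t \<Longrightarrow> \<mu> t = t"
proof -
  \<comment> \<open>The extra elements keep both sets nonempty when the cell is unbounded. They
    involve \<open>b\<close> so that the window from \<open>u\<close> to \<open>v\<close> holds both
    points; members of \<open>C\<close> on one side of \<open>a\<close> are on the same side of
    \<open>b\<close>.\<close>
  define L where "L = insert (min a b - 1) {c\<in>C. c < a}"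
  define U where "U = insert (max a b + 1) {c\<in>C. a < c}"
  define u where "u = Max L"
  define v where "v = Min U"
  have fin: "finite L" "L \<noteq> {}" "finite U" "U \<noteq> {}"
    using assms by (auto simp: L_def U_def)
  have "u \<in> L" "v \<in> U"
    using fin by (auto simp: u_def v_def)
  then have uv: "u < a" "a < v" "u < b" "b < v"
    using assms(3) by (auto simp: L_def U_def same_cell_iff)
  have Lu: "c \<le> u" if "c \<in> C" "c < a" for c
    using that fin by (auto simp: u_def L_def)
  have Uv: "v \<le> c" if "c \<in> C" "a < c" for c
    using that fin by (auto simp: v_def U_def)
  have C: "c \<le> u \<or> v \<le> c" if "c \<in> C" for c
    using that Lu Uv assms(2) by (metis linorder_less_linear)
  obtain \<mu> where \<mu>: "order_auto \<mu>" "\<mu> a = b" "\<And>t. t \<le> u \<or> v \<le> t \<Longrightarrow> \<mu> t = t"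
    using order_auto_move uv by blast
  have "same_cell C (\<mu> t) t" for t
  proof (cases "t \<le> u \<or> v \<le> t")
    case False
    then have "u < \<mu> t" "\<mu> t < v"
      using order_auto_less_iff[OF \<mu>(1)] \<mu>(3) by (metis not_le order_refl)+
    then show ?thesis
      using False C unfolding same_cell_iff by fastforce
  qed (use \<mu>(3) in simp)
  moreover have "\<mu> t = t" if t: "t \<notin> C" "\<not> same_cell C a t" for t
  proof (rule \<mu>(3))
    have "a \<noteq> t"
      using t by auto
    then consider "t < a" | "a < t"
      by linarith
    then show "t \<le> u \<or> v \<le> t"
    proof cases
      case 1
      then obtain c where "c \<in> C" "t < c" "c < a"
        using not_same_cellE[of C t a] t assms(2) same_cell_sym by metis
      then show ?thesis
        using Lu[of c] by simp
    next
      case 2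
      then obtain c where "c \<in> C" "a < c" "c < t"
        using not_same_cellE[of C a t] t assms(2) by metis
      then show ?thesis
        using Uv[of c] by simp
    qed
  qed
  ultimately show thesis
    using that \<mu> by blast
qed

text \<open>A cell contains at most one point of \<open>D\<close>, so the points can be moved one
  after the other: the map added for \<open>a\<close> is the identity on the other cells and leaves
  the earlier images in place.\<close>

lemma order_auto_moves:
  assumes "finite C" "finite D" "D \<inter> C = {}"
    and "\<And>a. a \<in> D \<Longrightarrow> same_cell C (b a) a"
    and "\<And>a a'. a \<in> D \<Longrightarrow> a' \<in> D \<Longrightarrow> same_cell C a a' \<Longrightarrow> a = a'"
  shows "\<exists>\<psi>. order_auto \<psi> \<and> (\<forall>a\<in>D. \<psi> a = b a) \<and> (\<forall>t. same_cell C (\<psi> t) t)"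
  using assms(2-5)
proof (induction D rule: finite_induct)
  case empty
  then show ?case
    using order_auto_id by (intro exI[of _ "\<lambda>t. t"]) simp
next
  case (insert a D)
  obtain \<psi> where \<psi>: "order_auto \<psi>" "\<And>a. a \<in> D \<Longrightarrow> \<psi> a = b a" "\<And>t. same_cell C (\<psi> t) t"
    using insert.IH insert.prems by (metis Int_insert_left insertCI insert_not_empty)
  have "\<psi> a \<notin> C" "same_cell C (\<psi> a) (b a)"
    using \<psi>(3)[of a] insert.prems(1) insert.prems(2)[of a] same_cell_notin same_cell_sym same_cell_trans
    by (blast, meson insertI1)
  \<comment> \<open>\<open>\<psi>\<close> is only known to keep \<open>a\<close> in its cell, so the
    new move starts at \<open>\<psi> a\<close>, not at \<open>a\<close>.\<close>
  then obtain \<mu> where \<mu>: "order_auto \<mu>" "\<mu> (\<psi> a) = b a" "\<And>t. same_cell C (\<mu> t) t"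
    "\<And>t. t \<notin> C \<Longrightarrow> \<not> same_cell C (\<psi> a) t \<Longrightarrow> \<mu> t = t"
    using order_auto_move_cell[OF assms(1)] by metis
  have "\<mu> (\<psi> a') = b a'" if "a' \<in> D" for a'
  proof -
    have a': "a' \<notin> C" "\<not> same_cell C a a'"
      using that insert.prems(1) insert.prems(3)[of a a'] insert.hyps by auto
    have "\<not> same_cell C (\<psi> a) (\<psi> a')"
      using same_cell_trans[OF same_cell_sym[OF \<psi>(3)] same_cell_trans[OF _ \<psi>(3)]] a'(2) by blast
    then show ?thesis
      using \<mu>(4)[OF same_cell_notin[OF \<psi>(3) a'(1)]] \<psi>(2)[OF that] by simp
  qed
  moreover have "same_cell C (\<mu> (\<psi> t)) t" for t
    using same_cell_trans[OF \<mu>(3) \<psi>(3)] .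
  ultimately show ?case
    using \<mu>(2) order_auto_comp[OF \<mu>(1) \<psi>(1)] by (intro exI[of _ "\<lambda>t. \<mu> (\<psi> t)"]) simp
qed

text \<open>In the application \<open>f\<close> is the new polynomial at one parameter,
  \<open>g\<close> the one at the other parameter after the old automorphism,
  \<open>\<delta>\<close> the derivative of \<open>f\<close>, and \<open>C\<close> the zeros of the
  old family with two far points. In \<open>mono\<close> the ends of the interval may lie in
  \<open>C\<close>, which allows comparison with values at cell boundaries.\<close>

locale comparable =
  fixes f g \<delta> :: "real \<Rightarrow> real" and C :: "real set"
  assumes finite_C: "finite C"
    and continuous_f: "continuous_on UNIV f"
    and continuous_g: "continuous_on UNIV g"
    and sgn_C: "c \<in> C \<Longrightarrow> sgn (f c) = sgn (g c)"
    and sgn_right: "(\<And>c. c \<in> C \<Longrightarrow> c \<le> t) \<Longrightarrow> sgn (f t) = sgn (g t)"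
    and sgn_left: "(\<And>c. c \<in> C \<Longrightarrow> t \<le> c) \<Longrightarrow> sgn (f t) = sgn (g t)"
    and \<delta>_nz: "t \<notin> C \<Longrightarrow> \<delta> t \<noteq> 0"
    and mono: "u < v \<Longrightarrow> u \<le> t \<Longrightarrow> t \<le> v \<Longrightarrow> t \<notin> C \<Longrightarrow> C \<inter> {u<..<v} = {} \<Longrightarrow>
      sgn (f v - f u) = sgn (\<delta> t) \<and> sgn (g v - g u) = sgn (\<delta> t)"
begin

text \<open>The hypotheses are symmetric in \<open>f\<close> and \<open>g\<close>, so zeros of
  \<open>g\<close> can be carried back to \<open>f\<close>.\<close>

lemma swap: "comparable g f \<delta> C"
proof
  show "sgn (g t) = sgn (f t)" if "\<And>c. c \<in> C \<Longrightarrow> c \<le> t" for t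
    using sgn_right[OF that] by simp
  show "sgn (g t) = sgn (f t)" if "\<And>c. c \<in> C \<Longrightarrow> t \<le> c" for t
    using sgn_left[OF that] by simp
  show "sgn (g v - g u) = sgn (\<delta> t) \<and> sgn (f v - f u) = sgn (\<delta> t)"
    if "u < v" "u \<le> t" "t \<le> v" "t \<notin> C" "C \<inter> {u<..<v} = {}" for u v t
    using mono[OF that] by simp
qed (simp_all add: finite_C continuous_f continuous_g sgn_C \<delta>_nz)

lemma neg: "comparable (\<lambda>t. - f t) (\<lambda>t. - g t) (\<lambda>t. - \<delta> t) C"
proof
  show "sgn (- f t) = sgn (- g t)" if "\<And>c. c \<in> C \<Longrightarrow> c \<le> t" for t
    using sgn_right[OF that] by (simp add: sgn_minus)
  show "sgn (- f t) = sgn (- g t)" if "\<And>c. c \<in> C \<Longrightarrow> t \<le> c" for t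
    using sgn_left[OF that] by (simp add: sgn_minus)
  show "sgn (- f v - - f u) = sgn (- \<delta> t) \<and> sgn (- g v - - g u) = sgn (- \<delta> t)"
    if "u < v" "u \<le> t" "t \<le> v" "t \<notin> C" "C \<inter> {u<..<v} = {}" for u v t
    using mono[OF that] sgn_minus[of "f v - f u"] sgn_minus[of "g v - g u"] by (simp add: sgn_minus)
qed (simp_all add: finite_C continuous_f continuous_g sgn_C \<delta>_nz continuous_on_minus sgn_minus)

lemma mono_same_cell:
  assumes "same_cell C u v" "u < v" "u \<notin> C"
  shows "sgn (f v - f u) = sgn (\<delta> u)" "sgn (f v - f u) = sgn (\<delta> v)"
    "sgn (g v - g u) = sgn (\<delta> u)" "sgn (g v - g u) = sgn (\<delta> v)"
proof -
  have "v \<notin> C" "C \<inter> {u<..<v} = {}"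
    using assms same_cell_notin same_cell_sym by (blast, force simp: same_cell_iff)
  then show "sgn (f v - f u) = sgn (\<delta> u)" "sgn (f v - f u) = sgn (\<delta> v)"
    "sgn (g v - g u) = sgn (\<delta> u)" "sgn (g v - g u) = sgn (\<delta> v)"
    using mono[of u v u] mono[of u v v] assms by auto
qed

lemma sgn_\<delta>:
  assumes "same_cell C u v" "u \<notin> C"
  shows "sgn (\<delta> u) = sgn (\<delta> v)"
proof -
  consider "u < v" | "u = v" | "v < u"
    by linarith
  then show ?thesis
  proof cases
    case 1
    then show ?thesis
      using mono_same_cell(1,2)[OF assms(1)] assms by simp
  next
    case 3
    then show ?thesis
      using mono_same_cell(1,2)[OF same_cell_sym[OF assms(1)]] assms
        same_cell_notin[OF same_cell_sym[OF assms(1)]] by simp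
  qed simp
qed

section \<open>Transfer of signs and zeros within a cell\<close>

lemma pos_near:
  fixes h :: "real \<Rightarrow> real"
  assumes "continuous_on UNIV h" "h c > 0"
  obtains e where "e > 0" "\<And>s. \<bar>s - c\<bar> < e \<Longrightarrow> h s > 0"
proof -
  have "h \<midarrow>c\<rightarrow> h c"
    using assms(1) by (simp add: continuous_on_eq_continuous_at isCont_def)
  then obtain e where "e > 0" "\<And>s. s \<noteq> c \<and> \<bar>c - s\<bar> < e \<Longrightarrow> h s > 0"
    using LIM_fun_gt_zero assms(2) by blast
  then show thesis
    using that[of e] assms(2) by (metis abs_minus_commute)
qed

text \<open>In a bounded cell \<open>f\<close> grows towards one of the endpoints. That endpoint is
  in \<open>C\<close>, so \<open>g\<close> is positive there along with \<open>f\<close>, and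
  continuity brings a positive value of \<open>g\<close> back into the cell. In an unbounded cell
  the signs agree at \<open>t\<close> itself.\<close>

lemma pos_transfer:
  assumes "t \<notin> C" "f t > 0"
  shows "\<exists>s. same_cell C s t \<and> g s > 0"
proof (cases "(\<forall>c\<in>C. c \<le> t) \<or> (\<forall>c\<in>C. t \<le> c)")
  case True
  then have "sgn (g t) = sgn (f t)"
    using sgn_left sgn_right by metis
  then show ?thesis
    using assms(2) by (intro exI[of _ t]) (simp add: sgn_if split: if_splits)
next
  case False
  define c where "c = Min {c\<in>C. t < c}"
  define c' where "c' = Max {c\<in>C. c < t}"
  have "c \<in> {c\<in>C. t < c}" "c' \<in> {c\<in>C. c < t}"
    unfolding c_def c'_def using False finite_C by (intro Min_in Max_in; force)+
  then have c: "c \<in> C" "t < c" "c' \<in> C" "c' < t"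
    by auto
  have le: "c \<le> d" if "d \<in> C" "t < d" for d
    using that finite_C unfolding c_def by simp
  have ge: "d \<le> c'" if "d \<in> C" "d < t" for d
    using that finite_C unfolding c'_def by simp
  have cell: "same_cell C s t" if "c' < s" "s < c" for s
    unfolding same_cell_iff
  proof (intro ballI)
    fix d assume d: "d \<in> C"
    then have "d \<noteq> t"
      using assms(1) by blast
    then show "(s < d) = (t < d) \<and> (d < s) = (d < t)"
      using le[OF d] ge[OF d] that by linarith
  qed
  consider "\<delta> t > 0" | "\<delta> t < 0"
    using \<delta>_nz assms(1) by (metis linorder_less_linear)
  then show ?thesis
  proof cases
    case 1
    have "C \<inter> {t<..<c} = {}"
      using le by force
    then have "sgn (f c - f t) = sgn (\<delta> t)"
      using mono[of t c t] c assms by simp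
    then have "f c > 0"
      using 1 assms(2) by (simp add: sgn_if split: if_splits)
    then have "g c > 0"
      using sgn_C[OF c(1)] by (simp add: sgn_if split: if_splits)
    then obtain e where e: "e > 0" "\<And>s. \<bar>s - c\<bar> < e \<Longrightarrow> g s > 0"
      using pos_near continuous_g by blast
    define s where "s = c - min (e / 2) ((c - t) / 2)"
    have "c' < s" "s < c" "\<bar>s - c\<bar> < e"
      using e c unfolding s_def by (auto simp: min_def field_simps)
    then show ?thesis
      using cell e(2) by blast
  next
    case 2
    have "C \<inter> {c'<..<t} = {}"
      using ge by force
    then have "sgn (f t - f c') = sgn (\<delta> t)"
      using mono[of c' t t] c assms by simp
    then have "f c' > 0"
      using 2 assms(2) by (simp add: sgn_if split: if_splits)
    then have "g c' > 0"
      using sgn_C[OF c(3)] by (simp add: sgn_if split: if_splits)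
    then obtain e where e: "e > 0" "\<And>s. \<bar>s - c'\<bar> < e \<Longrightarrow> g s > 0"
      using pos_near continuous_g by blast
    define s where "s = c' + min (e / 2) ((t - c') / 2)"
    have "c' < s" "s < c" "\<bar>s - c'\<bar> < e"
      using e c unfolding s_def by (auto simp: min_def field_simps)
    then show ?thesis
      using cell e(2) by blast
  qed
qed

lemma neg_transfer:
  assumes "t \<notin> C" "f t < 0"
  shows "\<exists>s. same_cell C s t \<and> g s < 0"
  using comparable.pos_transfer[OF neg, of t] assms by simp

lemma cell_open:
  assumes "t \<notin> C"
  obtains u v where "u < t" "t < v" "same_cell C u t" "same_cell C v t"
proof -
  have "open (- C)"
    using finite_C by (simp add: finite_imp_closed open_Compl)
  then obtain e where e: "e > 0" "\<And>s. \<bar>s - t\<bar> < e \<Longrightarrow> s \<notin> C"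
    using assms unfolding open_dist by (auto simp: dist_real_def)
  have "same_cell C s t" if "\<bar>s - t\<bar> < e" for s
    unfolding same_cell_iff
  proof (intro ballI)
    fix c assume "c \<in> C"
    then have "\<bar>c - t\<bar> \<ge> e"
      using e(2) by (meson not_le)
    then show "(s < c) = (t < c) \<and> (c < s) = (c < t)"
      using that by linarith
  qed
  then show thesis
    using e(1) by (intro that[of "t - e / 2" "t + e / 2"]) auto
qed

lemma zero_unique:
  assumes "s \<notin> C" "same_cell C s t" "f s = 0" "f t = 0"
  shows "s = t"
proof -
  have t: "t \<notin> C" "same_cell C t s"
    using assms same_cell_notin same_cell_sym by blast+
  have "\<delta> s \<noteq> 0" "\<delta> t \<noteq> 0"
    using assms t \<delta>_nz by blast+
  then have "\<not> s < t" "\<not> t < s"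
    using mono_same_cell(1)[OF assms(2)] mono_same_cell(1)[OF t(2)] assms t
    by (auto simp: sgn_0_0)
  then show ?thesis
    by simp
qed

lemma zero_between:
  assumes "same_cell C s s'" "g s > 0" "g s' < 0"
  obtains z where "same_cell C z s" "g z = 0"
proof (cases "s \<le> s'")
  case True
  then obtain z where z: "s \<le> z" "z \<le> s'" "g z = 0"
    using IVT2'[of g s' 0 s] assms(2,3) continuous_on_subset[OF continuous_g subset_UNIV]
    by (meson less_imp_le)
  show thesis
    using that[OF same_cell_between[OF assms(1) z(1,2)] z(3)] .
next
  case False
  then obtain z where z: "s' \<le> z" "z \<le> s" "g z = 0"
    using IVT'[of g s' 0 s] assms(2,3) continuous_on_subset[OF continuous_g subset_UNIV]
    by (meson less_imp_le linear)
  have "same_cell C z s'"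
    using same_cell_between[OF same_cell_sym[OF assms(1)] z(1,2)] .
  then show thesis
    using that z(3) same_cell_trans[OF _ same_cell_sym[OF assms(1)]] by blast
qed

text \<open>By strict monotonicity \<open>f\<close> takes both signs in the cell of its zero. Both
  signs carry over to \<open>g\<close>, and the intermediate value theorem applies.\<close>

lemma zero_transfer:
  assumes "t \<notin> C" "f t = 0"
  shows "\<exists>s. same_cell C s t \<and> g s = 0"
proof -
  obtain u v where uv: "u < t" "t < v" "same_cell C u t" "same_cell C v t"
    using cell_open[OF assms(1)] by blast
  have notin: "u \<notin> C" "v \<notin> C"
    using uv assms same_cell_notin by blast+
  have "sgn (f t - f u) = sgn (\<delta> t)" "sgn (f v - f t) = sgn (\<delta> t)"
    using mono_same_cell(2)[OF uv(3,1) notin(1)]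
      mono_same_cell(1)[OF same_cell_sym[OF uv(4)] uv(2) assms(1)] by auto
  moreover have "\<delta> t \<noteq> 0"
    using \<delta>_nz assms by blast
  ultimately have "(f u < 0 \<and> f v > 0) \<or> (f u > 0 \<and> f v < 0)"
    using assms(2) by (simp add: sgn_if split: if_splits)
  then obtain s1 s2 where s: "same_cell C s1 t" "g s1 > 0" "same_cell C s2 t" "g s2 < 0"
    using pos_transfer[of u] pos_transfer[of v] neg_transfer[of u] neg_transfer[of v] notin
      same_cell_trans[OF _ uv(3)] same_cell_trans[OF _ uv(4)] by blast
  obtain z where "same_cell C z s1" "g z = 0"
    using zero_between[OF same_cell_trans[OF s(1) same_cell_sym[OF s(3)]] s(2,4)] .
  then show ?thesis
    using same_cell_trans[OF _ s(1)] by blast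
qed

text \<open>If \<open>g\<close> were not positive at \<open>\<psi> t\<close>, it would have a zero
  in the cell, hence so would \<open>f\<close>, say at \<open>a\<close>. Then
  \<open>\<psi> a\<close> is a zero of \<open>g\<close>, and \<open>\<psi> t\<close> lies on the
  same side of it as \<open>t\<close> of \<open>a\<close>; equal directions of monotonicity force
  equal signs.\<close>

lemma pos_matched:
  assumes "order_auto \<psi>" "\<And>t. same_cell C (\<psi> t) t"
    and "\<And>a. a \<notin> C \<Longrightarrow> f a = 0 \<Longrightarrow> g (\<psi> a) = 0"
    and t: "t \<notin> C" "f t > 0"
  shows "g (\<psi> t) > 0"
proof (rule ccontr)
  assume neg: "\<not> g (\<psi> t) > 0"
  obtain s where s: "same_cell C s t" "g s > 0"
    using pos_transfer[OF t] by blast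
  have st: "same_cell C s (\<psi> t)"
    using same_cell_trans[OF s(1) same_cell_sym[OF assms(2)]] .
  have "\<exists>z. same_cell C z t \<and> g z = 0"
  proof (cases "g (\<psi> t) = 0")
    case False
    then show ?thesis
      using zero_between[OF st] neg s same_cell_trans[OF _ s(1)] by (metis linorder_less_linear)
  next
    case True
    then show ?thesis
      using assms(2) by (intro exI[of _ "\<psi> t"]) simp
  qed
  then obtain z where z: "same_cell C z t" "g z = 0"
    by blast
  have zC: "z \<notin> C"
    using z t same_cell_notin by blast
  then obtain a where a: "same_cell C a z" "f a = 0"
    using comparable.zero_transfer[OF swap zC z(2)] by blast
  have aC: "a \<notin> C"
    using same_cell_notin[OF a(1) zC] .
  then have "g (\<psi> a) = 0"
    using assms(3) a by blast
  have at: "same_cell C a t"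
    using same_cell_trans[OF a(1) z(1)] .
  have cells: "same_cell C (\<psi> a) (\<psi> t)" "\<psi> a \<notin> C" "\<psi> t \<notin> C" "same_cell C (\<psi> t) t"
    using same_cell_trans[OF same_cell_trans[OF assms(2) at] same_cell_sym[OF assms(2)]]
      same_cell_notin[OF assms(2)] assms(2) aC t(1) by auto
  have "a \<noteq> t"
    using a t by force
  then consider "a < t" | "t < a"
    by linarith
  then show False
  proof cases
    case 1
    have "sgn (f t - f a) = sgn (\<delta> t)"
      using mono_same_cell[of a t] 1 at aC by simp
    then have "\<delta> t > 0"
      using a t by (simp add: sgn_if split: if_splits)
    have "\<psi> a < \<psi> t"
      using 1 assms(1) order_auto_less_iff by blast
    then have "sgn (g (\<psi> t) - g (\<psi> a)) = sgn (\<delta> (\<psi> t))"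
      using mono_same_cell[of "\<psi> a" "\<psi> t"] cells by simp
    moreover have "sgn (\<delta> (\<psi> t)) = sgn (\<delta> t)"
      using sgn_\<delta> cells by blast
    ultimately show False
      using \<open>\<delta> t > 0\<close> \<open>g (\<psi> a) = 0\<close> neg by (simp add: sgn_if split: if_splits)
  next
    case 2
    have ta: "same_cell C t a"
      using at same_cell_sym by blast
    have "sgn (f a - f t) = sgn (\<delta> t)"
      using mono_same_cell[of t a] 2 ta t by simp
    then have "\<delta> t < 0"
      using a t by (simp add: sgn_if split: if_splits)
    have "\<psi> t < \<psi> a"
      using 2 assms(1) order_auto_less_iff by blast
    then have "sgn (g (\<psi> a) - g (\<psi> t)) = sgn (\<delta> (\<psi> t))"
      using mono_same_cell[OF same_cell_sym[OF cells(1)]] cells by simp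
    moreover have "sgn (\<delta> (\<psi> t)) = sgn (\<delta> t)"
      using sgn_\<delta> cells by blast
    ultimately show False
      using \<open>\<delta> t < 0\<close> \<open>g (\<psi> a) = 0\<close> neg by (simp add: sgn_if split: if_splits)
  qed
qed

text \<open>The zeros of \<open>f\<close> off \<open>C\<close> lie in different cells, so they can
  be sent simultaneously to zeros of \<open>g\<close> in the same cells; the remaining signs then
  agree by monotonicity.\<close>

lemma matching:
  assumes "finite {t. f t = 0}"
  obtains \<psi> where "order_auto \<psi>" "\<And>t. same_cell C (\<psi> t) t" "\<And>t. sgn (g (\<psi> t)) = sgn (f t)"
proof -
  define D where "D = {t. f t = 0} - C"
  define b where "b = (\<lambda>a. SOME s. same_cell C s a \<and> g s = 0)"
  have b: "same_cell C (b a) a \<and> g (b a) = 0" if "a \<in> D" for a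
    unfolding b_def by (rule someI_ex[OF zero_transfer]) (use that in \<open>auto simp: D_def\<close>)
  have "\<exists>\<psi>. order_auto \<psi> \<and> (\<forall>a\<in>D. \<psi> a = b a) \<and> (\<forall>t. same_cell C (\<psi> t) t)"
  proof (rule order_auto_moves)
    show "finite C" "finite D" "D \<inter> C = {}"
      using assms finite_C by (auto simp: D_def)
    show "same_cell C (b a) a" if "a \<in> D" for a
      using b that by blast
    show "a = a'" if "a \<in> D" "a' \<in> D" "same_cell C a a'" for a a'
      by (rule zero_unique) (use that in \<open>auto simp: D_def\<close>)
  qed
  then obtain \<psi> where \<psi>: "order_auto \<psi>" "\<And>a. a \<in> D \<Longrightarrow> \<psi> a = b a" "\<And>t. same_cell C (\<psi> t) t"
    by blast
  have zero: "g (\<psi> a) = 0" if "a \<notin> C" "f a = 0" for a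
    using that \<psi>(2) b by (simp add: D_def)
  have "sgn (g (\<psi> t)) = sgn (f t)" for t
  proof (cases "t \<in> C")
    case True
    then have "\<psi> t = t"
      using same_cell_fixed[OF same_cell_sym[OF \<psi>(3)]] by simp
    then show ?thesis
      using sgn_C True by simp
  next
    case False
    consider "f t = 0" | "f t > 0" | "f t < 0"
      by linarith
    then show ?thesis
    proof cases
      case 3
      then have "- g (\<psi> t) > 0"
        by (intro comparable.pos_matched[OF neg \<psi>(1,3)]) (use zero False in auto)
      then show ?thesis
        using 3 by simp
    qed (use zero False pos_matched[OF \<psi>(1,3)] in auto)
  qed
  then show thesis
    using that \<psi> by blast
qed

end

section \<open>Matching the signs of polynomials\<close>

lemma poly_sgn_at_top:
  fixes p :: "real poly"
  assumes "p \<noteq> 0"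
  obtains M where "\<And>t. t \<ge> M \<Longrightarrow> sgn (poly p t) = sgn (lead_coeff p)"
proof (cases "lead_coeff p > 0")
  case True
  then obtain M where M: "\<forall>t\<ge>M. poly p t \<ge> lead_coeff p"
    using poly_pinfty_gt_lc by blast
  show thesis
  proof (rule that)
    fix t assume "M \<le> t"
    then have "poly p t > 0"
      using M True by force
    then show "sgn (poly p t) = sgn (lead_coeff p)"
      using True by simp
  qed
next
  case False
  then have neg: "lead_coeff (- p) > 0"
    using assms by (simp add: lead_coeff_minus order_less_le)
  then obtain M where M: "\<forall>t\<ge>M. poly (- p) t \<ge> lead_coeff (- p)"
    using poly_pinfty_gt_lc by blast
  show thesis
  proof (rule that)
    fix t assume "M \<le> t"
    then have "poly (- p) t > 0"
      using M neg by force
    then show "sgn (poly p t) = sgn (lead_coeff p)"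
      using neg by (simp add: lead_coeff_minus)
  qed
qed

lemma poly_sgn_at_bot:
  fixes p :: "real poly"
  assumes "p \<noteq> 0"
  obtains M where "\<And>t. t \<le> M \<Longrightarrow> sgn (poly p t) = sgn (lead_coeff p) * (-1) ^ degree p"
proof -
  define q where "q = pcompose p [:0, -1:]"
  have lc: "lead_coeff q = lead_coeff p * (-1) ^ degree p"
    unfolding q_def by (subst lead_coeff_comp) auto
  then have "q \<noteq> 0"
    using assms by auto
  then obtain M where M: "\<And>t. t \<ge> M \<Longrightarrow> sgn (poly q t) = sgn (lead_coeff q)"
    using poly_sgn_at_top by blast
  have "sgn (poly p t) = sgn (lead_coeff p) * (-1) ^ degree p" if "t \<le> - M" for t
  proof -
    have "sgn ((-1 :: real) ^ degree p) = (-1) ^ degree p"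
      by (cases "even (degree p)") simp_all
    then show ?thesis
      using M[of "- t"] that by (simp add: q_def poly_pcompose lc[unfolded q_def] sgn_mult)
  qed
  then show thesis
    by (rule that)
qed

lemma poly_sgn_eq:
  fixes p :: "real poly"
  assumes "\<And>u. min s t \<le> u \<Longrightarrow> u \<le> max s t \<Longrightarrow> poly p u \<noteq> 0"
  shows "sgn (poly p s) = sgn (poly p t)"
proof (rule ccontr)
  assume neq: "sgn (poly p s) \<noteq> sgn (poly p t)"
  have "poly p s \<noteq> 0" "poly p t \<noteq> 0"
    using assms by auto
  then have "poly p s * poly p t < 0" "poly p t * poly p s < 0"
    using neq by (auto simp: mult_less_0_iff sgn_if split: if_splits)
  moreover have "s < t \<or> t < s"
    using neq by (metis linorder_less_linear)
  ultimately obtain u where "min s t < u" "u < max s t" "poly p u = 0"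
    using poly_IVT[of s t p] poly_IVT[of t s p] by (auto simp: min_def max_def)
  then show False
    using assms[of u] by simp
qed

text \<open>The inductive step at two fixed parameters, with \<open>(A, B)\<close> the values of one
  member at both. Matched derivatives make \<open>P\<close> and \<open>Q\<close> after
  \<open>\<phi>\<close> monotone in the same direction on each cell, so \<open>matching\<close>
  yields a correction of \<open>\<phi>\<close>. Every nonzero \<open>A\<close> has constant sign on
  cells, hence keeps its match.\<close>

lemma extend_matching:
  fixes P Q :: "real poly"
  assumes S: "finite S"
    and \<phi>: "order_auto \<phi>"
    and match: "\<And>A B t. (A, B) \<in> S \<Longrightarrow> sgn (poly B (\<phi> t)) = sgn (poly A t)"
    and deriv: "(pderiv P, pderiv Q) \<in> S" "pderiv P \<noteq> 0"
    and zeros: "\<And>A B t. (A, B) \<in> S \<Longrightarrow> A \<noteq> 0 \<Longrightarrow> poly A t = 0 \<Longrightarrow>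
      sgn (poly Q (\<phi> t)) = sgn (poly P t)"
    and lead: "degree Q = degree P" "sgn (lead_coeff Q) = sgn (lead_coeff P)"
  shows "\<exists>\<psi>. order_auto \<psi> \<and> (\<forall>(A, B)\<in>insert (P, Q) S. \<forall>t. sgn (poly B (\<psi> t)) = sgn (poly A t))"
proof -
  have P: "P \<noteq> 0" and Q: "Q \<noteq> 0"
    using deriv(2) lead(2) by (auto simp: sgn_0_0)
  \<comment> \<open>Zero polynomials are left out to keep \<open>roots\<close> finite; their signs
    survive any reparametrization.\<close>
  define roots where "roots = (\<Union>(A, B)\<in>{(A, B)\<in>S. A \<noteq> 0}. {t. poly A t = 0})"
  have "finite roots"
    unfolding roots_def using S
    by (intro finite_UN_I) (auto intro: rev_finite_subset poly_roots_finite)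
  obtain P1 P2 where P12: "\<And>t. t \<ge> P1 \<Longrightarrow> sgn (poly P t) = sgn (lead_coeff P)"
      "\<And>t. t \<le> P2 \<Longrightarrow> sgn (poly P t) = sgn (lead_coeff P) * (-1) ^ degree P"
    using poly_sgn_at_top[OF P] poly_sgn_at_bot[OF P] by metis
  obtain Q1 Q2 where Q12: "\<And>t. t \<ge> Q1 \<Longrightarrow> sgn (poly Q t) = sgn (lead_coeff Q)"
      "\<And>t. t \<le> Q2 \<Longrightarrow> sgn (poly Q t) = sgn (lead_coeff Q) * (-1) ^ degree Q"
    using poly_sgn_at_top[OF Q] poly_sgn_at_bot[OF Q] by metis
  obtain R1 R2 where R: "Q1 = \<phi> R1" "Q2 = \<phi> R2"
    using order_auto_surjE[OF \<phi>] by metis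
  \<comment> \<open>Beyond these points both signs are those of the leading terms. The thresholds
    for \<open>Q\<close> are pulled back because \<open>Q\<close> is evaluated at
    \<open>\<phi> t\<close>; equal degrees give equal parity on the left.\<close>
  define hi where "hi = max P1 R1"
  define lo where "lo = min P2 R2"
  have hi: "sgn (poly P t) = sgn (poly Q (\<phi> t))" if "hi \<le> t" for t
    using that P12(1)[of t] Q12(1)[of "\<phi> t"] lead by (simp add: hi_def R order_auto_le_iff[OF \<phi>])
  have lo: "sgn (poly P t) = sgn (poly Q (\<phi> t))" if "t \<le> lo" for t
    using that P12(2)[of t] Q12(2)[of "\<phi> t"] lead by (simp add: lo_def R order_auto_le_iff[OF \<phi>])
  define C where "C = insert lo (insert hi roots)"
  have C: "finite C" "lo \<in> C" "hi \<in> C"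
    using \<open>finite roots\<close> by (auto simp: C_def)
  have rootC: "t \<in> C" if "(A, B) \<in> S" "A \<noteq> 0" "poly A t = 0" for A B t
    using that by (auto simp: C_def roots_def)
  interpret comparable "poly P" "\<lambda>t. poly Q (\<phi> t)" "poly (pderiv P)" C
  proof
    show "continuous_on UNIV (\<lambda>t. poly Q (\<phi> t))"
      using order_auto_continuous[OF \<phi>] by (intro continuous_intros)
    show "sgn (poly P c) = sgn (poly Q (\<phi> c))" if "c \<in> C" for c
      using that hi[of c] lo[of c] zeros[of _ _ c] by (auto simp: C_def roots_def)
    show "sgn (poly P t) = sgn (poly Q (\<phi> t))" if "\<And>c. c \<in> C \<Longrightarrow> c \<le> t" for t
      using that[OF C(3)] hi by blast
    show "sgn (poly P t) = sgn (poly Q (\<phi> t))" if "\<And>c. c \<in> C \<Longrightarrow> t \<le> c" for t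
      using that[OF C(2)] lo by blast
    show "poly (pderiv P) t \<noteq> 0" if "t \<notin> C" for t
      using that rootC deriv by blast
    fix u v t assume t: "u < v" "u \<le> t" "t \<le> v" "t \<notin> C" "C \<inter> {u<..<v} = {}"
    \<comment> \<open>\<open>t\<close> may be an endpoint, but it is off \<open>C\<close>, like the
      open interval. The segment from \<open>z\<close> to \<open>t\<close> thus avoids all zeros of
      the derivative.\<close>
    have const: "sgn (poly (pderiv P) z) = sgn (poly (pderiv P) t)" if z: "u < z" "z < v" for z
    proof (rule poly_sgn_eq)
      fix w assume w: "min z t \<le> w" "w \<le> max z t"
      then have "w = t \<or> w \<in> {u<..<v}"
        using z t by (auto simp: min_def max_def split: if_splits)
      then have "w \<notin> C"
        using t by blast
      then show "poly (pderiv P) w \<noteq> 0"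
        using rootC deriv by blast
    qed
    have "sgn (poly P v - poly P u) = sgn (poly (pderiv P) t)"
    proof -
      obtain z where "u < z" "z < v" "poly P v - poly P u = (v - u) * poly (pderiv P) z"
        using poly_MVT[OF t(1)] by blast
      then show ?thesis
        using const t(1) by (simp add: sgn_mult)
    qed
    moreover have "sgn (poly Q (\<phi> v) - poly Q (\<phi> u)) = sgn (poly (pderiv P) t)"
    proof -
      have less: "\<phi> u < \<phi> v"
        using t(1) order_auto_less_iff[OF \<phi>] by blast
      \<comment> \<open>\<open>\<phi>\<close> need not be differentiable, so the mean value theorem
        is applied to \<open>Q\<close> on the image interval and the intermediate point is pulled
        back.\<close>
      obtain w where w: "\<phi> u < w" "w < \<phi> v"
        "poly Q (\<phi> v) - poly Q (\<phi> u) = (\<phi> v - \<phi> u) * poly (pderiv Q) w"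
        using poly_MVT[OF less] by blast
      obtain z where z: "w = \<phi> z"
        by (rule order_auto_surjE[OF \<phi>])
      have "u < z" "z < v"
        using w(1,2) order_auto_less_iff[OF \<phi>] unfolding z by blast+
      then show ?thesis
        using const[of z] match[OF deriv(1), of z] less w(3) by (simp add: sgn_mult z)
    qed
    ultimately show "sgn (poly P v - poly P u) = sgn (poly (pderiv P) t) \<and>
        sgn (poly Q (\<phi> v) - poly Q (\<phi> u)) = sgn (poly (pderiv P) t)"
      by blast
  qed (use C in \<open>auto intro: continuous_intros\<close>)
  obtain \<psi> where \<psi>: "order_auto \<psi>" "\<And>t. same_cell C (\<psi> t) t"
      "\<And>t. sgn (poly Q (\<phi> (\<psi> t))) = sgn (poly P t)"
    using matching[OF poly_roots_finite[OF P]] by metis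
  have "sgn (poly B (\<phi> (\<psi> t))) = sgn (poly A t)" if AB: "(A, B) \<in> S" for A B t
  proof -
    have "sgn (poly A (\<psi> t)) = sgn (poly A t)"
    proof (cases "A = 0 \<or> \<psi> t \<in> C")
      case True
      then have "A = 0 \<or> \<psi> t = t"
        using same_cell_fixed[OF \<psi>(2)] by blast
      then show ?thesis
        by (elim disjE) simp_all
    next
      case False
      show ?thesis
      proof (rule poly_sgn_eq)
        fix u assume u: "min (\<psi> t) t \<le> u" "u \<le> max (\<psi> t) t"
        have "same_cell C u (\<psi> t)"
        proof (cases "\<psi> t \<le> t")
          case True
          then show ?thesis
            using same_cell_between[OF \<psi>(2)] u by simp
        next
          case False
          then show ?thesis
            using same_cell_trans[OF same_cell_between[OF same_cell_sym[OF \<psi>(2)]]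
                same_cell_sym[OF \<psi>(2)]] u by simp
        qed
        then have "u \<notin> C"
          using same_cell_notin False by blast
        then show "poly A u \<noteq> 0"
          using rootC AB False by blast
      qed
    qed
    then show ?thesis
      using match[OF AB] by simp
  qed
  then show ?thesis
    using \<psi> order_auto_comp[OF \<phi> \<psi>(1)] by (intro exI[of _ "\<lambda>t. \<phi> (\<psi> t)"]) auto
qed

section \<open>Stratification of the parameter space\<close>

text \<open>Polynomials as functions of total assignments, which permits induction on their
  construction; formal polynomials return only in the last translation.\<close>

inductive_set polyfun :: "'i set \<Rightarrow> (('i \<Rightarrow> real) \<Rightarrow> real) set" for I :: "'i set" where
  polyfun_const: "(\<lambda>_. c) \<in> polyfun I"
| polyfun_var: "i \<in> I \<Longrightarrow> (\<lambda>a. a i) \<in> polyfun I"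
| polyfun_add: "f \<in> polyfun I \<Longrightarrow> g \<in> polyfun I \<Longrightarrow> (\<lambda>a. f a + g a) \<in> polyfun I"
| polyfun_mult: "f \<in> polyfun I \<Longrightarrow> g \<in> polyfun I \<Longrightarrow> (\<lambda>a. f a * g a) \<in> polyfun I"

lemma polyfun_minus: "f \<in> polyfun I \<Longrightarrow> (\<lambda>a. - f a) \<in> polyfun I"
  using polyfun_mult[OF polyfun_const[of "-1"]] by simp

lemma polyfun_diff: "f \<in> polyfun I \<Longrightarrow> g \<in> polyfun I \<Longrightarrow> (\<lambda>a. f a - g a) \<in> polyfun I"
  using polyfun_add[OF _ polyfun_minus, of f I g] by simp

lemma polyfun_sum: "(\<And>k. k \<in> K \<Longrightarrow> f k \<in> polyfun I) \<Longrightarrow> (\<lambda>a. \<Sum>k\<in>K. f k a) \<in> polyfun I"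
  by (induction K rule: infinite_finite_induct) (auto intro: polyfun.intros)

lemma polyfun_prod: "(\<And>k. k \<in> K \<Longrightarrow> f k \<in> polyfun I) \<Longrightarrow> (\<lambda>a. \<Prod>k\<in>K. f k a) \<in> polyfun I"
  by (induction K rule: infinite_finite_induct) (auto intro: polyfun.intros)

text \<open>Boolean closure is built in. The normal form demanded by \<open>semialgebraic\<close> is
  recovered in \<open>definable_Inl\<close>.\<close>

inductive definable :: "'i set \<Rightarrow> ('i \<Rightarrow> real) set \<Rightarrow> bool" for I :: "'i set" where
  definable_pos: "f \<in> polyfun I \<Longrightarrow> definable I {a. f a > 0}"
| definable_Compl: "definable I S \<Longrightarrow> definable I (- S)"
| definable_Int: "definable I S \<Longrightarrow> definable I T \<Longrightarrow> definable I (S \<inter> T)"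

lemma definable_UNIV: "definable I UNIV"
  using definable_pos[OF polyfun_const[of 1]] by simp

lemma definable_INT: "finite K \<Longrightarrow> (\<And>k. k \<in> K \<Longrightarrow> definable I (S k)) \<Longrightarrow> definable I (\<Inter>k\<in>K. S k)"
  by (induction K rule: finite_induct) (auto intro: definable_UNIV definable_Int)

lemma definable_UN: "finite K \<Longrightarrow> (\<And>k. k \<in> K \<Longrightarrow> definable I (S k)) \<Longrightarrow> definable I (\<Union>k\<in>K. S k)"
  using definable_Compl[OF definable_INT[of K I "\<lambda>k. - S k"]] definable_Compl by force

lemma definable_zero:
  assumes "f \<in> polyfun I"
  shows "definable I {a. f a = 0}"
proof -
  have "{a. f a = 0} = - {a. f a > 0} \<inter> - {a. - f a > 0}"
    by auto
  then show ?thesis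
    using assms by (simp only:) (intro definable_Int definable_Compl definable_pos polyfun_minus)
qed

text \<open>\<open>n\<close> is a length, one more than a degree bound, and uniform in the
  parameter: length 0 forces the zero polynomial, and the leading slot has index
  \<open>n - 1\<close> even where its coefficient vanishes.\<close>

definition pfam :: "'i set \<Rightarrow> nat \<Rightarrow> (('i \<Rightarrow> real) \<Rightarrow> real poly) \<Rightarrow> bool" where
  "pfam I n p \<longleftrightarrow> (\<forall>i. (\<lambda>a. coeff (p a) i) \<in> polyfun I) \<and> (\<forall>a. \<forall>i\<ge>n. coeff (p a) i = 0)"

lemma pfam_coeff: "pfam I n p \<Longrightarrow> (\<lambda>a. coeff (p a) i) \<in> polyfun I"
  by (simp add: pfam_def)

lemma pfam_coeff_0: "pfam I n p \<Longrightarrow> n \<le> i \<Longrightarrow> coeff (p a) i = 0"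
  by (simp add: pfam_def)

lemma pfam_mono: "pfam I m p \<Longrightarrow> m \<le> n \<Longrightarrow> pfam I n p"
  by (simp add: pfam_def)

lemma pfam_0: "pfam I 0 p \<Longrightarrow> p a = 0"
  by (simp add: pfam_def poly_eq_iff)

lemma pfam_pderiv: "pfam I (Suc n) p \<Longrightarrow> pfam I n (\<lambda>a. pderiv (p a))"
  by (auto simp: pfam_def coeff_pderiv intro!: polyfun_mult polyfun_const)

text \<open>At parameters where the leading slot vanishes, the truncation is \<open>p a\<close>
  itself, now with a shorter length.\<close>

lemma pfam_truncate:
  assumes "pfam I (Suc n) p"
  shows "pfam I n (\<lambda>a. p a - monom (coeff (p a) n) n)"
  unfolding pfam_def
proof (intro conjI allI impI)
  fix i
  have "(\<lambda>a. coeff (p a - monom (coeff (p a) n) n) i) =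
      (\<lambda>a. coeff (p a) i - (if n = i then coeff (p a) n else 0))"
    by auto
  also have "\<dots> \<in> polyfun I"
    using assms by (cases "n = i") (simp_all add: pfam_coeff polyfun_const)
  finally show "(\<lambda>a. coeff (p a - monom (coeff (p a) n) n) i) \<in> polyfun I" .
next
  fix a i assume "n \<le> i"
  then show "coeff (p a - monom (coeff (p a) n) n) i = 0"
    using pfam_coeff_0[OF assms, of i a] by auto
qed

text \<open>Pseudo-division in which every step multiplies by the square of the leading coefficient,
  so that signs at the zeros of the divisor are preserved.\<close>

lemma pfam_remainder:
  assumes q: "pfam I (Suc n) q"
  shows "pfam I m p \<Longrightarrow> \<exists>r. pfam I n r \<and> (\<forall>a t. coeff (q a) n \<noteq> 0 \<longrightarrow> poly (q a) t = 0 \<longrightarrow>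
    sgn (poly (r a) t) = sgn (poly (p a) t))"
proof (induction m arbitrary: p)
  case 0
  then show ?case
    using pfam_mono by blast
next
  case (Suc m)
  show ?case
  proof (cases "Suc m \<le> n")
    case True
    then show ?thesis
      using Suc.prems pfam_mono by blast
  next
    case False
    define b where "b = (\<lambda>a. coeff (q a) n)"
    \<comment> \<open>The coefficient of index \<open>m\<close> cancels, since \<open>b a\<close> is
      the coefficient of \<open>q a\<close> at \<open>n\<close> and
      \<open>n \<le> m\<close>.\<close>
    define p' where "p' = (\<lambda>a. smult (b a * b a) (p a) -
      smult (b a) (monom (coeff (p a) m) (m - n) * q a))"
    have p': "coeff (p' a) i = b a * b a * coeff (p a) i -
        b a * (if i < m - n then 0 else coeff (p a) m * coeff (q a) (i - (m - n)))" for a i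
      by (simp add: p'_def coeff_monom_mult)
    have "pfam I m p'"
      unfolding pfam_def
    proof (intro conjI allI impI)
      fix i
      have "(\<lambda>a. b a * (if i < m - n then 0 else coeff (p a) m * coeff (q a) (i - (m - n))))
          \<in> polyfun I"
        using q Suc.prems unfolding b_def
        by (cases "i < m - n") (auto intro!: polyfun_mult polyfun_const intro: pfam_coeff)
      then show "(\<lambda>a. coeff (p' a) i) \<in> polyfun I"
        unfolding p' using q Suc.prems unfolding b_def
        by (auto intro!: polyfun_diff polyfun_mult[of _ _ "\<lambda>a. coeff (p a) i"]
            polyfun_mult[of "\<lambda>a. coeff (q a) n" _ "\<lambda>a. coeff (q a) n"] intro: pfam_coeff)
    next
      fix a i assume "m \<le> i"
      show "coeff (p' a) i = 0"
      proof (cases "i = m")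
        case True
        then show ?thesis
          using False by (simp add: p' b_def)
      next
        case neq: False
        then have "coeff (p a) i = 0" "coeff (q a) (i - (m - n)) = 0"
          using \<open>m \<le> i\<close> False by (auto intro!: pfam_coeff_0[OF Suc.prems] pfam_coeff_0[OF q])
        then show ?thesis
          by (simp add: p')
      qed
    qed
    then obtain r where r: "pfam I n r" "\<And>a t. coeff (q a) n \<noteq> 0 \<Longrightarrow> poly (q a) t = 0 \<Longrightarrow>
        sgn (poly (r a) t) = sgn (poly (p' a) t)"
      using Suc.IH by blast
    have "sgn (poly (p' a) t) = sgn (poly (p a) t)" if "coeff (q a) n \<noteq> 0" "poly (q a) t = 0" for a t
    proof -
      have "poly (p' a) t = (b a * b a) * poly (p a) t" "sgn (b a * b a) = 1"
        using that by (simp_all add: p'_def b_def zero_less_mult_iff linorder_neq_iff disj_commute)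
      then show ?thesis
        by (simp only: sgn_mult[of "b a * b a"] mult_1)
    qed
    then show ?thesis
      using r by (intro exI[of _ r]) simp
  qed
qed

section \<open>Sign equivalence of parameters and induction on lengths\<close>

type_synonym 'a family = "(nat \<times> ('a \<Rightarrow> real poly)) multiset"

definition sign_equiv :: "'a family \<Rightarrow> 'a \<Rightarrow> 'a \<Rightarrow> bool" where
  "sign_equiv F x y \<longleftrightarrow> (\<exists>\<phi>. order_auto \<phi> \<and>
     (\<forall>e\<in>#F. \<forall>t. sgn (poly (snd e y) (\<phi> t)) = sgn (poly (snd e x) t)))"

text \<open>Equivalence is required only inside \<open>S\<close>, so a stratification of the whole
  space for a simpler family can be restricted to a subset on which that family determines the
  original one.\<close>

definition stratified :: "'i set \<Rightarrow> ('i \<Rightarrow> real) family \<Rightarrow> ('i \<Rightarrow> real) set \<Rightarrow> bool" where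
  "stratified I F S \<longleftrightarrow> (\<exists>\<C>. finite \<C> \<and> (\<forall>C\<in>\<C>. definable I C) \<and> S \<subseteq> \<Union>\<C> \<and>
     (\<forall>C\<in>\<C>. \<forall>x\<in>C \<inter> S. \<forall>y\<in>C \<inter> S. sign_equiv F x y))"

lemma stratified_subset:
  assumes "stratified I F S" "T \<subseteq> S"
    and "\<And>x y. x \<in> T \<Longrightarrow> y \<in> T \<Longrightarrow> sign_equiv F x y \<Longrightarrow> sign_equiv G x y"
  shows "stratified I G T"
proof -
  obtain \<C> where \<C>: "finite \<C>" "\<forall>C\<in>\<C>. definable I C" "S \<subseteq> \<Union>\<C>"
      "\<forall>C\<in>\<C>. \<forall>x\<in>C \<inter> S. \<forall>y\<in>C \<inter> S. sign_equiv F x y"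
    using assms(1) unfolding stratified_def by blast
  show ?thesis
    unfolding stratified_def
  proof (intro exI[of _ \<C>] conjI ballI)
    fix C x y assume "C \<in> \<C>" "x \<in> C \<inter> T" "y \<in> C \<inter> T"
    then show "sign_equiv G x y"
      using \<C>(4) assms(2) by (intro assms(3)) auto
  qed (use \<C> assms(2) in auto)
qed

text \<open>Cells are cut with their piece \<open>S k\<close>, because outside it their points need
  not be equivalent; this is where the pieces must be definable.\<close>

lemma stratified_UN:
  assumes K: "finite K" and def: "\<And>k. k \<in> K \<Longrightarrow> definable I (S k)"
    and strat: "\<And>k. k \<in> K \<Longrightarrow> stratified I F (S k)"
  shows "stratified I F (\<Union>k\<in>K. S k)"
proof -
  define W where "W = (\<lambda>k \<C>. finite \<C> \<and> (\<forall>C\<in>\<C>. definable I C) \<and> S k \<subseteq> \<Union>\<C> \<and>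
     (\<forall>C\<in>\<C>. \<forall>x\<in>C \<inter> S k. \<forall>y\<in>C \<inter> S k. sign_equiv F x y))"
  have "\<forall>k\<in>K. \<exists>\<C>. W k \<C>"
    using strat unfolding stratified_def W_def by blast
  then obtain \<C> where W: "\<forall>k\<in>K. W k (\<C> k)"
    by metis
  have \<C>: "finite (\<C> k)" "\<And>C. C \<in> \<C> k \<Longrightarrow> definable I C" "S k \<subseteq> \<Union>(\<C> k)"
      "\<And>C x y. C \<in> \<C> k \<Longrightarrow> x \<in> C \<inter> S k \<Longrightarrow> y \<in> C \<inter> S k \<Longrightarrow> sign_equiv F x y"
    if "k \<in> K" for k
    using bspec[OF W that] unfolding W_def by blast+
  define \<D> where "\<D> = (\<Union>k\<in>K. (\<lambda>C. C \<inter> S k) ` \<C> k)"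
  have \<D>E: "\<exists>k\<in>K. \<exists>C'\<in>\<C> k. C = C' \<inter> S k" if "C \<in> \<D>" for C
    using that by (auto simp: \<D>_def)
  show ?thesis
    unfolding stratified_def
  proof (intro exI[of _ \<D>] conjI ballI)
    show "finite \<D>"
      unfolding \<D>_def using K \<C>(1) by blast
    show "definable I C" if "C \<in> \<D>" for C
      using \<D>E[OF that] definable_Int \<C>(2) def by metis
    show "(\<Union>k\<in>K. S k) \<subseteq> \<Union>\<D>"
    proof
      fix x assume "x \<in> (\<Union>k\<in>K. S k)"
      then obtain k where k: "k \<in> K" "x \<in> S k"
        by blast
      then obtain C where "C \<in> \<C> k" "x \<in> C"
        using \<C>(3) by blast
      then show "x \<in> \<Union>\<D>"
        using k unfolding \<D>_def by blast
    qed
    show "sign_equiv F x y"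
      if C: "C \<in> \<D>" "x \<in> C \<inter> (\<Union>k\<in>K. S k)" "y \<in> C \<inter> (\<Union>k\<in>K. S k)" for C x y
    proof -
      obtain k C' where "k \<in> K" "C' \<in> \<C> k" "C = C' \<inter> S k"
        using \<D>E[OF C(1)] by blast
      then show ?thesis
        using \<C>(4)[of k C' x y] C(2,3) by blast
    qed
  qed
qed

text \<open>One entry may be traded for any number of strictly shorter ones. The number of
  remainders grows with the family, which is why the measure is a multiset.\<close>

lemma lengths_less:
  fixes Q K :: "(nat \<times> 'b) multiset"
  assumes "\<And>k. k \<in># K \<Longrightarrow> fst k < fst e"
  shows "image_mset fst (Q + K) < image_mset fst (add_mset e Q)"
proof -
  have "multp (<) (image_mset fst Q + image_mset fst K) (image_mset fst Q + {#fst e#})"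
    by (rule one_step_implies_multp) (use assms in auto)
  then show ?thesis
    by (simp add: less_multiset_def)
qed

text \<open>The automorphism for the smaller family sends zeros of a member at \<open>x\<close> to
  zeros at \<open>y\<close>. At such zeros \<open>p\<close> has the sign of the remainder, and the
  remainders are matched; this provides the comparison at zeros in
  \<open>extend_matching\<close>.\<close>

lemma sign_equiv_extend:
  assumes p: "pfam I (Suc n) p" "n > 0"
    and Q: "\<And>e. e \<in># Q \<Longrightarrow> pfam I (fst e) (snd e)" "(n, \<lambda>a. pderiv (p a)) \<in># Q"
    and rem: "\<And>e a t. e \<in># Q \<Longrightarrow> fst e > 0 \<Longrightarrow> coeff (snd e a) (fst e - 1) \<noteq> 0 \<Longrightarrow>
      poly (snd e a) t = 0 \<Longrightarrow> sgn (poly (r e a) t) = sgn (poly (p a) t)"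
    and sim: "sign_equiv (Q + image_mset (\<lambda>e. (fst e - 1, r e)) (filter_mset (\<lambda>e. fst e > 0) Q)) x y"
    and lead: "\<And>e. e \<in># Q \<Longrightarrow> fst e > 0 \<Longrightarrow>
      coeff (snd e x) (fst e - 1) \<noteq> 0 \<and> coeff (snd e y) (fst e - 1) \<noteq> 0"
    and sgn: "coeff (p x) n \<noteq> 0" "sgn (coeff (p x) n) = sgn (coeff (p y) n)"
  shows "sign_equiv (add_mset (Suc n, p) Q) x y"
proof -
  define R where "R = image_mset (\<lambda>e. (fst e - 1, r e)) (filter_mset (\<lambda>e. fst e > 0) Q)"
  obtain \<phi> where \<phi>': "order_auto \<phi>"
      "\<And>e t. e \<in># Q + R \<Longrightarrow> sgn (poly (snd e y) (\<phi> t)) = sgn (poly (snd e x) t)"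
    using sim unfolding sign_equiv_def R_def by blast
  have "(fst e - 1, r e) \<in># R" if "e \<in># Q" "fst e > 0" for e
    using that by (force simp: R_def)
  then have \<phi>: "order_auto \<phi>"
      "\<And>e t. e \<in># Q \<Longrightarrow> sgn (poly (snd e y) (\<phi> t)) = sgn (poly (snd e x) t)"
      "\<And>e t. e \<in># Q \<Longrightarrow> fst e > 0 \<Longrightarrow> sgn (poly (r e y) (\<phi> t)) = sgn (poly (r e x) t)"
    using \<phi>' by fastforce+
  define S where "S = (\<lambda>e. (snd e x, snd e y)) ` set_mset Q"
  \<comment> \<open>Members of length 0 have no leading slot and get no remainder; being zero, they
    are exempt from the comparison at zeros.\<close>
  have nz: "fst e > 0" if "e \<in># Q" "snd e x \<noteq> 0" for e
    using that Q(1) pfam_0 by (metis gr0I)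
  have deg: "degree (p z) = n" if "coeff (p z) n \<noteq> 0" for z
    using that pfam_coeff_0[OF p(1)] by (intro antisym degree_le le_degree) auto
  have y: "coeff (p y) n \<noteq> 0"
    using sgn by (metis sgn_0_0)
  have "\<exists>\<psi>. order_auto \<psi> \<and> (\<forall>(A, B)\<in>insert (p x, p y) S. \<forall>t. sgn (poly B (\<psi> t)) = sgn (poly A t))"
  proof (rule extend_matching)
    show "finite S"
      by (simp add: S_def)
    show "order_auto \<phi>"
      by (rule \<phi>(1))
    show "sgn (poly B (\<phi> t)) = sgn (poly A t)" if "(A, B) \<in> S" for A B t
      using that \<phi>(2) unfolding S_def by auto
    show "(pderiv (p x), pderiv (p y)) \<in> S"
      using Q(2) unfolding S_def by force
    have "coeff (pderiv (p x)) (n - 1) \<noteq> 0"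
      using sgn p(2) by (simp add: coeff_pderiv)
    then show "pderiv (p x) \<noteq> 0"
      by auto
    show "degree (p y) = degree (p x)" "sgn (lead_coeff (p y)) = sgn (lead_coeff (p x))"
      using deg sgn y by auto
    fix A B t assume A: "(A, B) \<in> S" "A \<noteq> 0" "poly A t = 0"
    then obtain e where e: "e \<in># Q" "A = snd e x" "B = snd e y"
      unfolding S_def by auto
    have "fst e > 0"
      using nz e A by blast
    moreover have "poly (snd e y) (\<phi> t) = 0"
      using \<phi>(2)[OF e(1), of t] A e by (simp add: sgn_0_0)
    ultimately show "sgn (poly (p y) (\<phi> t)) = sgn (poly (p x) t)"
      using rem[of e x t] rem[of e y "\<phi> t"] lead[of e] e A \<phi>(3)[of e t] by simp
  qed
  then obtain \<psi> where \<psi>: "order_auto \<psi>"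
      "\<forall>(A, B)\<in>insert (p x, p y) S. \<forall>t. sgn (poly B (\<psi> t)) = sgn (poly A t)"
    by blast
  show ?thesis
    unfolding sign_equiv_def
  proof (intro exI[of _ \<psi>] conjI ballI allI)
    fix e t assume "e \<in># add_mset (Suc n, p) Q"
    then have "(snd e x, snd e y) \<in> insert (p x, p y) S"
      by (auto simp: S_def)
    then show "sgn (poly (snd e y) (\<psi> t)) = sgn (poly (snd e x) t)"
      using \<psi>(2) by blast
  qed (rule \<psi>(1))
qed

text \<open>The space is split into the zero sets of the leading slots and the set \<open>E\<close>
  where none vanishes, the latter by the sign of one longest member. On every piece the family
  reduces to one with a smaller multiset of lengths.\<close>

lemma stratified_UNIV:
  fixes I :: "'i set"
  assumes "\<And>e. e \<in># F \<Longrightarrow> pfam I (fst e) (snd e)"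
  shows "stratified I F UNIV"
  using assms
proof (induction "image_mset fst F" arbitrary: F rule: less_induct)
  case less
  note pfam = less.prems
  show ?case
  proof (cases "\<forall>e\<in>#F. fst e = 0")
    case True
    have "sign_equiv F x y" for x y
      unfolding sign_equiv_def using order_auto_id True pfam pfam_0 by (metis poly_0)
    then show ?thesis
      unfolding stratified_def by (intro exI[of _ "{UNIV}"]) (simp add: definable_UNIV)
  next
    case False
    define lc where "lc = (\<lambda>e :: nat \<times> (('i \<Rightarrow> real) \<Rightarrow> real poly). \<lambda>a. coeff (snd e a) (fst e - 1))"
    define P where "P = {e. e \<in># F \<and> fst e > 0}"
    have P: "finite P"
      unfolding P_def by (rule finite_subset[of _ "set_mset F"]) auto
    have PE: "\<exists>n q. e = (Suc n, q) \<and> e \<in># F" if "e \<in> P" for e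
      using that by (cases e) (auto simp: P_def gr0_conv_Suc)
    have lc: "lc e \<in> polyfun I" if "e \<in># F" for e
      using pfam_coeff[OF pfam[OF that]] by (simp add: lc_def)
    have Z: "stratified I F {a. lc e a = 0}" if eP: "e \<in> P" for e
    proof -
      obtain n q where e: "e = (Suc n, q)" "e \<in># F"
        using PE[OF eP] by blast
      define q' where "q' = (\<lambda>a. q a - monom (coeff (q a) n) n)"
      have q': "pfam I n q'"
        using pfam[OF e(2)] e(1) unfolding q'_def by (intro pfam_truncate) simp
      have F: "F = add_mset e (F - {#e#})"
        using e(2) by simp
      have "image_mset fst (F - {#e#} + {#(n, q')#}) < image_mset fst F"
        by (subst (2) F, rule lengths_less) (simp add: e(1))
      moreover have "pfam I (fst e') (snd e')" if "e' \<in># F - {#e#} + {#(n, q')#}" for e'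
        using that q' pfam in_diffD[of e' F "{#e#}"] by auto
      ultimately have "stratified I (F - {#e#} + {#(n, q')#}) UNIV"
        by (intro less.hyps) auto
      then show ?thesis
      proof (rule stratified_subset)
        fix x y assume xy: "x \<in> {a. lc e a = 0}" "y \<in> {a. lc e a = 0}"
          "sign_equiv (F - {#e#} + {#(n, q')#}) x y"
        have "q' x = q x" "q' y = q y"
          using xy by (auto simp: q'_def lc_def e)
        moreover obtain \<phi> where \<phi>: "order_auto \<phi>"
          "\<And>e' t. e' \<in># F - {#e#} + {#(n, q')#} \<Longrightarrow> sgn (poly (snd e' y) (\<phi> t)) = sgn (poly (snd e' x) t)"
          using xy(3) unfolding sign_equiv_def by blast
        ultimately have "sgn (poly (snd e' y) (\<phi> t)) = sgn (poly (snd e' x) t)" if e': "e' \<in># F" for e' t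
        proof (cases "e' = e")
          case True
          then show ?thesis
            using \<phi>(2)[of "(n, q')" t] \<open>q' x = q x\<close> \<open>q' y = q y\<close> e(1) by simp
        next
          case False
          have "e' \<in># F - {#e#}"
            using e' False by (subst (asm) F) simp
          then show ?thesis
            using \<phi>(2)[of e' t] by simp
        qed
        then show "sign_equiv F x y"
          using \<phi>(1) unfolding sign_equiv_def by blast
      qed simp
    qed
    \<comment> \<open>A remainder is shorter than its divisor. With \<open>e\<close> of maximal
      length, all remainders are thus shorter than \<open>e\<close>.\<close>
    obtain e where e: "e \<in> P" "\<And>e'. e' \<in># F \<Longrightarrow> fst e' \<le> fst e"
    proof -
      have "F \<noteq> {#}"
        using False by auto
      then have "Max (fst ` set_mset F) \<in> fst ` set_mset F"
        by (intro Max_in) auto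
      then obtain e where e: "e \<in># F" "fst e = Max (fst ` set_mset F)"
        by force
      then have "fst e' \<le> fst e" if "e' \<in># F" for e'
        using that by simp
      moreover from this have "e \<in> P"
        using e(1) False unfolding P_def by force
      ultimately show thesis
        using that by blast
    qed
    obtain n p where np: "e = (Suc n, p)" "e \<in># F"
      using PE[OF e(1)] by blast
    define Q where "Q = F - {#e#}"
    have F: "F = add_mset (Suc n, p) Q"
      using np by (simp add: Q_def)
    have p: "pfam I (Suc n) p"
      using pfam[OF np(2)] np(1) by simp
    have pQ: "pfam I (fst e') (snd e')" "fst e' \<le> Suc n" if "e' \<in># Q" for e'
      using that pfam[of e'] e(2)[of e'] np(1) in_diffD unfolding Q_def by force+
    define E where "E = (\<Inter>e\<in>P. - {a. lc e a = 0})"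
    have E: "definable I E"
      unfolding E_def using P lc by (intro definable_INT definable_Compl definable_zero) (auto simp: P_def)
    have lead: "stratified I F {a \<in> E. sgn (lc e a) = \<sigma>}" for \<sigma>
    \<comment> \<open>For length 1 the member is constant in the variable with sign
      \<open>\<sigma>\<close> at both parameters, so every automorphism that serves \<open>Q\<close>
      serves it too. For \<open>n > 0\<close> the derivative is nonzero on \<open>E\<close>, as the
      extension step requires.\<close>
    proof (cases "n = 0")
      case True
      have "image_mset fst (Q + {#}) < image_mset fst F"
        unfolding F by (rule lengths_less) simp
      then have "stratified I Q UNIV"
        using pQ(1) by (intro less.hyps) auto
      then show ?thesis
      proof (rule stratified_subset)
        fix x y assume xy: "x \<in> {a \<in> E. sgn (lc e a) = \<sigma>}" "y \<in> {a \<in> E. sgn (lc e a) = \<sigma>}"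
          "sign_equiv Q x y"
        have "p z = [:lc e z:]" for z
        proof (rule poly_eqI)
          show "coeff (p z) i = coeff [:lc e z:] i" for i
            using pfam_coeff_0[OF p, of i z] True by (cases i) (simp_all add: lc_def np(1))
        qed
        then have "poly (p z) t = lc e z" for z t
          by simp
        then have "sgn (poly (p y) t) = sgn (poly (p x) t')" for t t'
          using xy by simp
        then show "sign_equiv F x y"
          using xy(3) unfolding F sign_equiv_def by auto
      qed simp
    next
      case False
      then have n: "n > 0"
        by simp
      \<comment> \<open>The derivative is also a divisor, since \<open>p\<close> must be compared at
        the zeros of its derivative as well.\<close>
      define Q' where "Q' = add_mset (n, \<lambda>a. pderiv (p a)) Q"
      have pQ': "pfam I (fst e') (snd e')" "fst e' \<le> Suc n" if "e' \<in># Q'" for e'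
        using that pQ[of e'] pfam_pderiv[OF p] unfolding Q'_def by auto
      have "\<exists>r. pfam I (fst e' - 1) r \<and> (\<forall>a t. coeff (snd e' a) (fst e' - 1) \<noteq> 0 \<longrightarrow>
          poly (snd e' a) t = 0 \<longrightarrow> sgn (poly (r a) t) = sgn (poly (p a) t))"
        if "e' \<in># Q' \<and> fst e' > 0" for e'
        using pfam_remainder[of I "fst e' - 1" "snd e'", OF _ p] pQ'(1)[of e'] that by simp
      then obtain r where r: "\<And>e'. e' \<in># Q' \<and> fst e' > 0 \<Longrightarrow> pfam I (fst e' - 1) (r e')"
        "\<And>e' a t. e' \<in># Q' \<and> fst e' > 0 \<Longrightarrow> coeff (snd e' a) (fst e' - 1) \<noteq> 0 \<Longrightarrow>
          poly (snd e' a) t = 0 \<Longrightarrow> sgn (poly (r e' a) t) = sgn (poly (p a) t)"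
        by metis
      define R where "R = image_mset (\<lambda>e. (fst e - 1, r e)) (filter_mset (\<lambda>e. fst e > 0) Q')"
      have "image_mset fst (Q + ({#(n, \<lambda>a. pderiv (p a))#} + R)) < image_mset fst F"
        unfolding F
      proof (rule lengths_less)
        fix k assume "k \<in># {#(n, \<lambda>a. pderiv (p a))#} + R"
        then consider "fst k = n" | e' where "e' \<in># Q'" "fst e' > 0" "fst k = fst e' - 1"
          by (auto simp: R_def)
        then show "fst k < fst (Suc n, p)"
        proof cases
          case 2
          then show ?thesis
            using pQ'(2)[of e'] by simp
        qed simp
      qed
      then have "image_mset fst (Q' + R) < image_mset fst F"
        by (simp add: Q'_def)
      then have "stratified I (Q' + R) UNIV"
        using pQ'(1) r(1) by (intro less.hyps) (auto simp: R_def)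
      then show ?thesis
      proof (rule stratified_subset)
        fix x y assume xy: "x \<in> {a \<in> E. sgn (lc e a) = \<sigma>}" "y \<in> {a \<in> E. sgn (lc e a) = \<sigma>}"
          "sign_equiv (Q' + R) x y"
        have nz: "lc e' x \<noteq> 0" "lc e' y \<noteq> 0" if "e' \<in># F" "fst e' > 0" for e'
        proof -
          have "e' \<in> P"
            using that by (simp add: P_def)
          then show "lc e' x \<noteq> 0" "lc e' y \<noteq> 0"
            using xy(1,2) unfolding E_def by blast+
        qed
        have sgn: "coeff (p x) n \<noteq> 0" "sgn (coeff (p x) n) = sgn (coeff (p y) n)"
            "coeff (p y) n \<noteq> 0"
          using nz[OF np(2)] xy(1,2) np(1) by (simp_all add: lc_def)
        have "sign_equiv (add_mset (Suc n, p) Q') x y"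
        proof (rule sign_equiv_extend[OF p n pQ'(1)])
          show "sgn (poly (r e' a) t) = sgn (poly (p a) t)"
            if "e' \<in># Q'" "fst e' > 0" "coeff (snd e' a) (fst e' - 1) \<noteq> 0" "poly (snd e' a) t = 0"
            for e' a t
            using r(2) that by blast
          show "coeff (snd e' x) (fst e' - 1) \<noteq> 0 \<and> coeff (snd e' y) (fst e' - 1) \<noteq> 0"
            if e': "e' \<in># Q'" "fst e' > 0" for e'
          proof (cases "e' \<in># Q")
            case True
            then show ?thesis
              using nz[of e'] e'(2) by (simp add: lc_def F)
          next
            \<comment> \<open>Here \<open>e'\<close> is the derivative, whose leading slot is
              \<open>n\<close> times that of \<open>p\<close>.\<close>
            case False
            then show ?thesis
              using e'(1) sgn n by (auto simp: Q'_def coeff_pderiv)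
          qed
        qed (use xy(3) sgn in \<open>simp_all add: Q'_def R_def\<close>)
        then show "sign_equiv F x y"
          unfolding sign_equiv_def F Q'_def by auto
      qed simp
    qed
    define S where "S = (\<lambda>k. case k of Inl e' \<Rightarrow> {a. lc e' a = 0} |
      Inr \<sigma> \<Rightarrow> {a \<in> E. sgn (lc e a) = \<sigma>})"
    define K :: "((nat \<times> (('i \<Rightarrow> real) \<Rightarrow> real poly)) + real) set" where "K = Inl ` P \<union> Inr ` {1, -1}"
    have "stratified I F (\<Union>k\<in>K. S k)"
    proof (rule stratified_UN)
      show "finite K"
        using P by (simp add: K_def)
      fix k assume "k \<in> K"
      then consider e' where "k = Inl e'" "e' \<in> P" | \<sigma> where "k = Inr \<sigma>" "\<sigma> \<in> {1, -1}"
        unfolding K_def by blast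
      then have "definable I (S k) \<and> stratified I F (S k)"
      proof cases
        case 1
        then show ?thesis
          using Z[of e'] definable_zero[OF lc, of e'] by (simp add: S_def P_def)
      next
        case 2
        then have "S k = E \<inter> {a. \<sigma> * lc e a > 0}"
          by (auto simp: S_def sgn_if split: if_splits)
        moreover have "definable I {a. \<sigma> * lc e a > 0}"
          by (intro definable_pos polyfun_mult polyfun_const lc np(2))
        ultimately have "definable I (S k)"
          using definable_Int[OF E] by simp
        then show ?thesis
          using lead 2 by (simp add: S_def)
      qed
      then show "definable I (S k)" "stratified I F (S k)"
        by blast+
    qed
    moreover have "(\<Union>k\<in>K. S k) = UNIV"
    proof -
      have "a \<in> (\<Union>k\<in>K. S k)" for a
      proof (cases "a \<in> E")
        case True
        then have "lc e a \<noteq> 0"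
          using e(1) unfolding E_def by blast
        then have "sgn (lc e a) = 1 \<or> sgn (lc e a) = - 1"
          by (simp add: sgn_if)
        then show ?thesis
          using True unfolding K_def S_def by force
      next
        case False
        then show ?thesis
          unfolding E_def K_def S_def by force
      qed
      then show ?thesis
        by blast
    qed
    ultimately show ?thesis
      by simp
  qed
qed

section \<open>Projections of definable sets\<close>

text \<open>Powers of coordinate \<open>i\<close> are collected; the coefficients involve only
  coordinates in \<open>I\<close> and do not see the update at \<open>i\<close>.\<close>

lemma polyfun_insert:
  assumes "f \<in> polyfun (insert i I)" "i \<notin> I"
  shows "\<exists>n p. pfam I n p \<and> (\<forall>a t. f (a(i := t)) = poly (p a) t)"
  using assms(1)
proof induction
  case (polyfun_const c)
  have "pfam I 1 (\<lambda>a. [:c:])"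
    by (auto simp: pfam_def coeff_pCons split: nat.splits intro!: polyfun.polyfun_const)
  then show ?case
    by (intro exI[of _ 1] exI[of _ "\<lambda>a. [:c:]"]) simp
next
  case (polyfun_var j)
  show ?case
  proof (cases "j = i")
    case True
    have "pfam I 2 (\<lambda>a. [:0, 1:])"
      by (auto simp: pfam_def coeff_pCons split: nat.splits intro!: polyfun.polyfun_const)
    then show ?thesis
      using True by (intro exI[of _ 2] exI[of _ "\<lambda>a. [:0, 1:]"]) simp
  next
    case False
    have "(\<lambda>a. coeff [:a j:] m) \<in> polyfun I" for m
      using False polyfun_var by (cases m) (auto intro: polyfun.intros)
    then have "pfam I 1 (\<lambda>a. [:a j:])"
      by (auto simp: pfam_def coeff_pCons split: nat.splits)
    then show ?thesis
      using False by (intro exI[of _ 1] exI[of _ "\<lambda>a. [:a j:]"]) simp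
  qed
next
  case (polyfun_add f g)
  then obtain n p m q where *: "pfam I n p" "\<And>a t. f (a(i := t)) = poly (p a) t"
      "pfam I m q" "\<And>a t. g (a(i := t)) = poly (q a) t"
    by blast
  have "pfam I (max n m) (\<lambda>a. p a + q a)"
    using *(1,3) by (auto simp: pfam_def intro: polyfun.polyfun_add)
  then show ?case
    by (intro exI[of _ "max n m"] exI[of _ "\<lambda>a. p a + q a"]) (simp only: * poly_add simp_thms)
next
  case (polyfun_mult f g)
  then obtain n p m q where *: "pfam I n p" "\<And>a t. f (a(i := t)) = poly (p a) t"
      "pfam I m q" "\<And>a t. g (a(i := t)) = poly (q a) t"
    by blast
  have "pfam I (n + m) (\<lambda>a. p a * q a)"
    unfolding pfam_def
  proof (intro conjI allI impI)
    show "(\<lambda>a. coeff (p a * q a) k) \<in> polyfun I" for k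
      unfolding coeff_mult using *(1,3) by (intro polyfun_sum polyfun.polyfun_mult pfam_coeff)
    show "coeff (p a * q a) k = 0" if "n + m \<le> k" for a k
      unfolding coeff_mult
    proof (rule sum.neutral, rule ballI)
      fix j assume "j \<in> {..k}"
      then have "n \<le> j \<or> m \<le> k - j"
        using that by auto
      then show "coeff (p a) j * coeff (q a) (k - j) = 0"
        using pfam_coeff_0[OF *(1)] pfam_coeff_0[OF *(3)] by auto
    qed
  qed
  then show ?case
    by (intro exI[of _ "n + m"] exI[of _ "\<lambda>a. p a * q a"]) (simp only: * poly_mult simp_thms)
qed

text \<open>Two parameters and two values occur because membership will be transported from
  \<open>t\<close> over one parameter to \<open>\<phi> t\<close> over an equivalent one.\<close>

lemma definable_by_signs:
  assumes "definable (insert i I) B" "i \<notin> I"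
  shows "\<exists>F. (\<forall>e\<in>#F. pfam I (fst e) (snd e)) \<and> (\<forall>a a' t t'.
    (\<forall>e\<in>#F. sgn (poly (snd e a') t') = sgn (poly (snd e a) t)) \<longrightarrow>
    (a(i := t) \<in> B \<longleftrightarrow> a'(i := t') \<in> B))"
  using assms(1)
proof induction
  case (definable_pos f)
  obtain n p where p: "pfam I n p" "\<And>a t. f (a(i := t)) = poly (p a) t"
    using polyfun_insert[OF definable_pos assms(2)] by blast
  show ?case
  proof (intro exI[of _ "{#(n, p)#}"] conjI allI impI)
    fix a a' t t'
    assume "\<forall>e\<in>#{#(n, p)#}. sgn (poly (snd e a') t') = sgn (poly (snd e a) t)"
    then have "sgn (f (a'(i := t'))) = sgn (f (a(i := t)))"
      unfolding p(2) by simp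
    then show "a(i := t) \<in> {a. f a > 0} \<longleftrightarrow> a'(i := t') \<in> {a. f a > 0}"
      unfolding mem_Collect_eq sgn_eq_iff by blast
  qed (use p(1) in simp)
next
  case (definable_Compl S)
  then show ?case
    by simp
next
  case (definable_Int S T)
  then obtain F G where FG: "\<forall>e\<in>#F. pfam I (fst e) (snd e)" "\<forall>e\<in>#G. pfam I (fst e) (snd e)"
    "\<forall>a a' t t'. (\<forall>e\<in>#F. sgn (poly (snd e a') t') = sgn (poly (snd e a) t)) \<longrightarrow>
      (a(i := t) \<in> S \<longleftrightarrow> a'(i := t') \<in> S)"
    "\<forall>a a' t t'. (\<forall>e\<in>#G. sgn (poly (snd e a') t') = sgn (poly (snd e a) t)) \<longrightarrow>
      (a(i := t) \<in> T \<longleftrightarrow> a'(i := t') \<in> T)"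
    by blast
  show ?case
  proof (intro exI[of _ "F + G"] conjI allI impI)
    fix a a' t t'
    assume "\<forall>e\<in>#F + G. sgn (poly (snd e a') t') = sgn (poly (snd e a) t)"
    then have "a(i := t) \<in> S \<longleftrightarrow> a'(i := t') \<in> S" "a(i := t) \<in> T \<longleftrightarrow> a'(i := t') \<in> T"
      using FG(3)[rule_format, of a' t' a t] FG(4)[rule_format, of a' t' a t] by auto
    then show "a(i := t) \<in> S \<inter> T \<longleftrightarrow> a'(i := t') \<in> S \<inter> T"
      by simp
  qed (use FG(1,2) in auto)
qed

lemma definable_projection:
  assumes "definable (insert i I) B" "i \<notin> I"
  shows "definable I {a. \<exists>t. a(i := t) \<in> B}"
proof -
  obtain F where F: "\<And>e. e \<in># F \<Longrightarrow> pfam I (fst e) (snd e)"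
    "\<And>a a' t t'. (\<And>e. e \<in># F \<Longrightarrow> sgn (poly (snd e a') t') = sgn (poly (snd e a) t)) \<Longrightarrow>
      a(i := t) \<in> B \<longleftrightarrow> a'(i := t') \<in> B"
    using definable_by_signs[OF assms] by metis
  obtain \<C> where \<C>: "finite \<C>" "\<And>C. C \<in> \<C> \<Longrightarrow> definable I C" "UNIV \<subseteq> \<Union>\<C>"
      "\<And>C x y. C \<in> \<C> \<Longrightarrow> x \<in> C \<Longrightarrow> y \<in> C \<Longrightarrow> sign_equiv F x y"
    using stratified_UNIV[of F I] F(1) unfolding stratified_def by auto
  \<comment> \<open>A cell that meets the projection lies inside it, so the projection is the union
    of these cells.\<close>
  define \<D> where "\<D> = {C \<in> \<C>. \<exists>x\<in>C. \<exists>t. x(i := t) \<in> B}"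
  have "\<exists>t. y(i := t) \<in> B" if C: "C \<in> \<C>" "x \<in> C" "y \<in> C" and t: "x(i := t) \<in> B" for C x y t
  proof -
    obtain \<phi> where "\<And>e. e \<in># F \<Longrightarrow> sgn (poly (snd e y) (\<phi> t)) = sgn (poly (snd e x) t)"
      using \<C>(4)[OF C] unfolding sign_equiv_def by blast
    then show ?thesis
      using F(2)[of y "\<phi> t" x t] t by blast
  qed
  then have inv: "\<exists>t. y(i := t) \<in> B" if "C \<in> \<D>" "y \<in> C" for C y
    using that unfolding \<D>_def by blast
  have "{a. \<exists>t. a(i := t) \<in> B} = (\<Union>C\<in>\<D>. C)"
  proof (intro equalityI subsetI)
    fix a assume a: "a \<in> {a. \<exists>t. a(i := t) \<in> B}"
    obtain C where "C \<in> \<C>" "a \<in> C"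
      using \<C>(3) by blast
    then show "a \<in> (\<Union>C\<in>\<D>. C)"
      using a unfolding \<D>_def by blast
  qed (use inv in blast)
  moreover have "definable I (\<Union>C\<in>\<D>. C)"
    by (rule definable_UN) (use \<C>(1,2) in \<open>simp_all add: \<D>_def\<close>)
  ultimately show ?thesis
    by simp
qed

text \<open>Agreement off \<open>V\<close> expresses a block of existential quantifiers without
  ordering the variables; the values of \<open>a\<close> on \<open>V\<close> are ignored.\<close>

lemma definable_projections:
  assumes "finite V" "V \<inter> I = {}" "definable (V \<union> I) B"
  shows "definable I {a. \<exists>b\<in>B. \<forall>i. i \<notin> V \<longrightarrow> b i = a i}"
  using assms
proof (induction V arbitrary: B rule: finite_induct)
  case empty
  have "{a. \<exists>b\<in>B. \<forall>i. i \<notin> {} \<longrightarrow> b i = a i} = B"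
    by (auto simp: fun_eq_iff[symmetric])
  then show ?case
    using empty by simp
next
  case (insert v V)
  have "definable (V \<union> I) {a. \<exists>t. a(v := t) \<in> B}"
    using insert.hyps insert.prems by (intro definable_projection) auto
  then have "definable I {a. \<exists>b\<in>{a. \<exists>t. a(v := t) \<in> B}. \<forall>i. i \<notin> V \<longrightarrow> b i = a i}"
    using insert.IH insert.prems by blast
  moreover have "{a. \<exists>b\<in>{a. \<exists>t. a(v := t) \<in> B}. \<forall>i. i \<notin> V \<longrightarrow> b i = a i} =
      {a. \<exists>b\<in>B. \<forall>i. i \<notin> insert v V \<longrightarrow> b i = a i}" (is "?L = ?R")
  proof (intro equalityI subsetI)
    fix a assume "a \<in> ?L"
    then obtain b t where "b(v := t) \<in> B" "\<forall>i. i \<notin> V \<longrightarrow> b i = a i"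
      by blast
    then show "a \<in> ?R"
      by (auto intro!: bexI[of _ "b(v := t)"])
  next
    fix a assume "a \<in> ?R"
    then obtain b where b: "b \<in> B" "\<forall>i. i \<notin> insert v V \<longrightarrow> b i = a i"
      by blast
    then have "(b(v := a v))(v := b v) \<in> B"
      by simp
    then have "b(v := a v) \<in> {a. \<exists>t. a(v := t) \<in> B}"
      by blast
    moreover have "\<forall>i. i \<notin> V \<longrightarrow> (b(v := a v)) i = a i"
      using b(2) by simp
    ultimately show "a \<in> ?L"
      by blast
  qed
  ultimately show ?case
    by simp
qed

section \<open>From definable to semialgebraic sets\<close>

definition mono_eval :: "('i \<Rightarrow>\<^sub>0 nat) \<Rightarrow> ('i \<Rightarrow> real) \<Rightarrow> real" where
  "mono_eval m a = (\<Prod>i\<in>Poly_Mapping.keys m. a i ^ Poly_Mapping.lookup m i)"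

lemma mono_eval_superset:
  assumes "finite K" "Poly_Mapping.keys m \<subseteq> K"
  shows "mono_eval m a = (\<Prod>i\<in>K. a i ^ Poly_Mapping.lookup m i)"
  unfolding mono_eval_def using assms
  by (intro prod.mono_neutral_left) (auto simp: in_keys_iff)

lemma mono_eval_add: "mono_eval (m + m') a = mono_eval m a * mono_eval m' a"
proof -
  let ?K = "Poly_Mapping.keys m \<union> Poly_Mapping.keys m'"
  have "mono_eval n a = (\<Prod>i\<in>?K. a i ^ Poly_Mapping.lookup n i)" if "n \<in> {m, m', m + m'}" for n
    using that keys_add[of m m'] by (intro mono_eval_superset) auto
  then show ?thesis
    by (simp add: lookup_add power_add prod.distrib)
qed

text \<open>Terms may cancel in \<open>p + q\<close>. Summation over a common superset of the
  supports makes additivity a termwise statement.\<close>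

lemma mpoly_eval_superset:
  assumes "finite K" "Poly_Mapping.keys p \<subseteq> K"
  shows "mpoly_eval p a = (\<Sum>m\<in>K. Poly_Mapping.lookup p m * mono_eval m a)"
  unfolding mpoly_eval_def mono_eval_def[symmetric] using assms
  by (intro sum.mono_neutral_left) (auto simp: in_keys_iff)

lemma mpoly_eval_add: "mpoly_eval (p + q) a = mpoly_eval p a + mpoly_eval q a"
proof -
  let ?K = "Poly_Mapping.keys p \<union> Poly_Mapping.keys q"
  have "mpoly_eval r a = (\<Sum>m\<in>?K. Poly_Mapping.lookup r m * mono_eval m a)"
    if "r \<in> {p, q, p + q}" for r
    using that keys_add[of p q] by (intro mpoly_eval_superset) auto
  then show ?thesis
    by (simp add: lookup_add distrib_right sum.distrib)
qed

lemma mpoly_eval_single: "mpoly_eval (Poly_Mapping.single m c) a = c * mono_eval m a"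
  by (subst mpoly_eval_superset[of "{m}"]) auto

lemma mpoly_eval_zero [simp]: "mpoly_eval 0 a = 0"
  by (simp add: mpoly_eval_def)

definition mpoly_functions :: "'i set \<Rightarrow> (('i \<Rightarrow> real) \<Rightarrow> real) set" where
  "mpoly_functions I = mpoly_eval ` polys_in I"

lemma zero_polys_in: "0 \<in> polys_in I"
  by (simp add: polys_in_def)

lemma mpoly_functions_single:
  assumes "Poly_Mapping.keys m \<subseteq> I"
  shows "(\<lambda>a. c * mono_eval m a) \<in> mpoly_functions I"
proof -
  have "Poly_Mapping.single m c \<in> polys_in I"
    using assms by (simp add: polys_in_def)
  moreover have "mpoly_eval (Poly_Mapping.single m c) = (\<lambda>a. c * mono_eval m a)"
    by (simp add: fun_eq_iff mpoly_eval_single)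
  ultimately show ?thesis
    unfolding mpoly_functions_def by (metis imageI)
qed

lemma mpoly_functions_add:
  assumes "f \<in> mpoly_functions I" "g \<in> mpoly_functions I"
  shows "(\<lambda>a. f a + g a) \<in> mpoly_functions I"
proof -
  obtain p q where pq: "p \<in> polys_in I" "q \<in> polys_in I" "f = mpoly_eval p" "g = mpoly_eval q"
    using assms unfolding mpoly_functions_def by blast
  have "p + q \<in> polys_in I"
    using pq(1,2) keys_add[of p q] unfolding polys_in_def by blast
  moreover have "mpoly_eval (p + q) = (\<lambda>a. f a + g a)"
    using pq by (simp add: fun_eq_iff mpoly_eval_add)
  ultimately show ?thesis
    unfolding mpoly_functions_def by (metis imageI)
qed

lemma mpoly_functions_const: "(\<lambda>_. c) \<in> mpoly_functions I"
  using mpoly_functions_single[of 0 I c] by (simp add: mono_eval_def)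

lemma mpoly_functions_sum:
  "(\<And>k. k \<in> K \<Longrightarrow> f k \<in> mpoly_functions I) \<Longrightarrow> (\<lambda>a. \<Sum>k\<in>K. f k a) \<in> mpoly_functions I"
  by (induction K rule: infinite_finite_induct)
    (auto intro: mpoly_functions_const mpoly_functions_add)

lemma mpoly_functions_var:
  assumes "i \<in> I"
  shows "(\<lambda>a. a i) \<in> mpoly_functions I"
proof -
  have "mono_eval (Poly_Mapping.single i 1) a = a i" for a
    by (subst mono_eval_superset[of "{i}"]) auto
  then show ?thesis
    using mpoly_functions_single[of "Poly_Mapping.single i 1" I 1] assms by simp
qed

lemma mpoly_functions_mult:
  assumes "f \<in> mpoly_functions I" "g \<in> mpoly_functions I"
  shows "(\<lambda>a. f a * g a) \<in> mpoly_functions I"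
proof -
  obtain p q where pq: "p \<in> polys_in I" "q \<in> polys_in I" "f = mpoly_eval p" "g = mpoly_eval q"
    using assms unfolding mpoly_functions_def by blast
  have eval: "mpoly_eval r a = (\<Sum>m\<in>Poly_Mapping.keys r. Poly_Mapping.lookup r m * mono_eval m a)"
    for r a
    by (rule mpoly_eval_superset) auto
  have "mpoly_eval p a * mpoly_eval q a = (\<Sum>m\<in>Poly_Mapping.keys p. \<Sum>m'\<in>Poly_Mapping.keys q.
      (Poly_Mapping.lookup p m * Poly_Mapping.lookup q m') * mono_eval (m + m') a)" for a
    by (simp only: eval sum_product mono_eval_add mult.assoc
        mult.left_commute[of "mono_eval _ _" "Poly_Mapping.lookup _ _"])
  then have "(\<lambda>a. f a * g a) = (\<lambda>a. \<Sum>m\<in>Poly_Mapping.keys p. \<Sum>m'\<in>Poly_Mapping.keys q.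
      (Poly_Mapping.lookup p m * Poly_Mapping.lookup q m') * mono_eval (m + m') a)"
    by (simp only: pq(3,4))
  also have "\<dots> \<in> mpoly_functions I"
  proof (intro mpoly_functions_sum mpoly_functions_single)
    fix m m' assume "m \<in> Poly_Mapping.keys p" "m' \<in> Poly_Mapping.keys q"
    then show "Poly_Mapping.keys (m + m') \<subseteq> I"
      using keys_add[of m m'] pq(1,2) unfolding polys_in_def by blast
  qed
  finally show ?thesis .
qed

text \<open>Only one equation is available; over the reals \<open>p = 0\<close> and
  \<open>q = 0\<close> merge into the vanishing of the sum of their squares.\<close>

lemma basic_semialgebraic_Int:
  assumes "basic_semialgebraic I S" "basic_semialgebraic I T"
  shows "basic_semialgebraic I (S \<inter> T)"
proof -
  obtain p P where p: "p \<in> polys_in I" "finite P" "P \<subseteq> polys_in I"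
      "S = {a \<in> I \<rightarrow>\<^sub>E UNIV. mpoly_eval p a = 0 \<and> (\<forall>q\<in>P. mpoly_eval q a > 0)}"
    using assms(1) unfolding basic_semialgebraic_def by blast
  obtain q Q where q: "q \<in> polys_in I" "finite Q" "Q \<subseteq> polys_in I"
      "T = {a \<in> I \<rightarrow>\<^sub>E UNIV. mpoly_eval q a = 0 \<and> (\<forall>q\<in>Q. mpoly_eval q a > 0)}"
    using assms(2) unfolding basic_semialgebraic_def by blast
  have "(\<lambda>a. mpoly_eval p a * mpoly_eval p a + mpoly_eval q a * mpoly_eval q a) \<in> mpoly_functions I"
    using p(1) q(1) by (intro mpoly_functions_add mpoly_functions_mult) (auto simp: mpoly_functions_def)
  then obtain r where "r \<in> polys_in I"
      "(\<lambda>a. mpoly_eval p a * mpoly_eval p a + mpoly_eval q a * mpoly_eval q a) = mpoly_eval r"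
    unfolding mpoly_functions_def by blast
  then have r: "r \<in> polys_in I" "mpoly_eval r a = 0 \<longleftrightarrow> mpoly_eval p a = 0 \<and> mpoly_eval q a = 0" for a
    by (auto simp: fun_eq_iff sum_squares_eq_zero_iff[symmetric])
  show ?thesis
    unfolding basic_semialgebraic_def
    by (intro exI[of _ r] exI[of _ "P \<union> Q"]) (use p q r in auto)
qed

lemma semialgebraic_basic: "basic_semialgebraic I S \<Longrightarrow> semialgebraic I S"
  unfolding semialgebraic_def by (intro exI[of _ "{S}"]) simp

lemma semialgebraic_Un:
  assumes "semialgebraic I S" "semialgebraic I T"
  shows "semialgebraic I (S \<union> T)"
proof -
  obtain F G where "finite F" "\<forall>B\<in>F. basic_semialgebraic I B" "S = \<Union>F"
      "finite G" "\<forall>B\<in>G. basic_semialgebraic I B" "T = \<Union>G"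
    using assms unfolding semialgebraic_def by blast
  then show ?thesis
    unfolding semialgebraic_def by (intro exI[of _ "F \<union> G"]) auto
qed

lemma semialgebraic_Int:
  assumes "semialgebraic I S" "semialgebraic I T"
  shows "semialgebraic I (S \<inter> T)"
proof -
  obtain F G where FG: "finite F" "\<forall>B\<in>F. basic_semialgebraic I B" "S = \<Union>F"
      "finite G" "\<forall>B\<in>G. basic_semialgebraic I B" "T = \<Union>G"
    using assms unfolding semialgebraic_def by blast
  show ?thesis
    unfolding semialgebraic_def
  proof (intro exI[of _ "(\<lambda>(A, B). A \<inter> B) ` (F \<times> G)"] conjI)
    show "\<forall>B\<in>(\<lambda>(A, B). A \<inter> B) ` (F \<times> G). basic_semialgebraic I B"
      using FG by (auto intro: basic_semialgebraic_Int)
  qed (use FG in auto)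
qed

lemma semialgebraic_pos:
  assumes "f \<in> mpoly_functions I"
  shows "semialgebraic I {a \<in> I \<rightarrow>\<^sub>E UNIV. f a > 0}"
proof (rule semialgebraic_basic)
  obtain p where "p \<in> polys_in I" "f = mpoly_eval p"
    using assms unfolding mpoly_functions_def by blast
  then show "basic_semialgebraic I {a \<in> I \<rightarrow>\<^sub>E UNIV. f a > 0}"
    unfolding basic_semialgebraic_def
    by (intro exI[of _ 0] exI[of _ "{p}"]) (simp add: zero_polys_in)
qed

lemma semialgebraic_zero:
  assumes "f \<in> mpoly_functions I"
  shows "semialgebraic I {a \<in> I \<rightarrow>\<^sub>E UNIV. f a = 0}"
proof (rule semialgebraic_basic)
  obtain p where "p \<in> polys_in I" "f = mpoly_eval p"
    using assms unfolding mpoly_functions_def by blast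
  then show "basic_semialgebraic I {a \<in> I \<rightarrow>\<^sub>E UNIV. f a = 0}"
    unfolding basic_semialgebraic_def
    by (intro exI[of _ p] exI[of _ "{}"]) simp
qed

lemma polyfun_Inl:
  assumes "f \<in> polyfun (Inl ` I)"
  shows "(\<lambda>a. f (case_sum a b)) \<in> mpoly_functions I"
  using assms
proof induction
  case (polyfun_var i)
  then show ?case
    by (auto intro: mpoly_functions_var)
qed (intro mpoly_functions_const mpoly_functions_add mpoly_functions_mult; assumption)+

text \<open>The complement is carried along so that negations move down to the atoms, where failure
  of \<open>f a > 0\<close> splits into \<open>- f a > 0\<close> or \<open>f a = 0\<close>. The
  filler \<open>b\<close> completes \<open>a\<close> to a total assignment.\<close>

lemma definable_Inl:
  assumes "definable (Inl ` I) S"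
  shows "semialgebraic I {a \<in> I \<rightarrow>\<^sub>E UNIV. case_sum a b \<in> S} \<and>
    semialgebraic I {a \<in> I \<rightarrow>\<^sub>E UNIV. case_sum a b \<notin> S}"
  using assms
proof induction
  case (definable_pos f)
  have f: "(\<lambda>a. f (case_sum a b)) \<in> mpoly_functions I"
    using polyfun_Inl[OF definable_pos] .
  have "(\<lambda>a. - 1 * f (case_sum a b)) \<in> mpoly_functions I"
    by (intro mpoly_functions_mult mpoly_functions_const f)
  then have "semialgebraic I ({a \<in> I \<rightarrow>\<^sub>E UNIV. - 1 * f (case_sum a b) > 0} \<union>
      {a \<in> I \<rightarrow>\<^sub>E UNIV. f (case_sum a b) = 0})"
    by (intro semialgebraic_Un semialgebraic_pos semialgebraic_zero f)
  moreover have "{a \<in> I \<rightarrow>\<^sub>E UNIV. - 1 * f (case_sum a b) > 0} \<union> {a \<in> I \<rightarrow>\<^sub>E UNIV. f (case_sum a b) = 0} =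
      {a \<in> I \<rightarrow>\<^sub>E UNIV. case_sum a b \<notin> {a. f a > 0}}"
    by auto
  ultimately show ?case
    using semialgebraic_pos[OF f] by simp
next
  case (definable_Compl S)
  then show ?case
    by simp
next
  case (definable_Int S T)
  have "{a \<in> I \<rightarrow>\<^sub>E UNIV. case_sum a b \<in> S \<inter> T} =
      {a \<in> I \<rightarrow>\<^sub>E UNIV. case_sum a b \<in> S} \<inter> {a \<in> I \<rightarrow>\<^sub>E UNIV. case_sum a b \<in> T}"
    "{a \<in> I \<rightarrow>\<^sub>E UNIV. case_sum a b \<notin> S \<inter> T} =
      {a \<in> I \<rightarrow>\<^sub>E UNIV. case_sum a b \<notin> S} \<union> {a \<in> I \<rightarrow>\<^sub>E UNIV. case_sum a b \<notin> T}"
    by blast+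
  then show ?case
    using semialgebraic_Int[OF conjunct1[OF definable_Int.IH(1)] conjunct1[OF definable_Int.IH(2)]]
      semialgebraic_Un[OF conjunct2[OF definable_Int.IH(1)] conjunct2[OF definable_Int.IH(2)]]
    by (simp only: simp_thms)
qed

section \<open>Outer-product rank\<close>

text \<open>The tensors are unfolded into the entries of their vectors, which leaves one polynomial
  equation per entry of \<open>A\<close>.\<close>

definition has_rank_le :: "nat \<Rightarrow> (nat \<Rightarrow> nat) \<Rightarrow> nat \<Rightarrow> ((nat \<Rightarrow> nat) \<Rightarrow> real) \<Rightarrow> bool" where
  "has_rank_le k d r A \<longleftrightarrow> (\<exists>x :: nat \<Rightarrow> nat \<Rightarrow> nat \<Rightarrow> real.
     \<forall>j\<in>multi_index k d. A j = (\<Sum>s<r. \<Prod>i<k. x s i (j i)))"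

lemma finite_multi_index: "finite (multi_index k d)"
  by (simp add: multi_index_def finite_PiE)

lemma has_rank_le_iff:
  assumes "A \<in> arrays k d"
  shows "(\<exists>T. (\<forall>s<r. decomposable k d (T s)) \<and> A = (\<lambda>j\<in>multi_index k d. \<Sum>s<r. T s j)) \<longleftrightarrow>
    has_rank_le k d r A"
proof
  assume "\<exists>T. (\<forall>s<r. decomposable k d (T s)) \<and> A = (\<lambda>j\<in>multi_index k d. \<Sum>s<r. T s j)"
  then obtain T where T: "\<forall>s<r. decomposable k d (T s)" "A = (\<lambda>j\<in>multi_index k d. \<Sum>s<r. T s j)"
    by blast
  obtain x where x: "\<And>s. s < r \<Longrightarrow> T s = outer_product k d (x s)"
    using T(1) unfolding decomposable_def by metis
  have "A j = (\<Sum>s<r. \<Prod>i<k. x s i (j i))" if "j \<in> multi_index k d" for j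
    using that by (simp add: T(2) x outer_product_def)
  then show "has_rank_le k d r A"
    unfolding has_rank_le_def by blast
next
  assume "has_rank_le k d r A"
  then obtain x where x: "\<And>j. j \<in> multi_index k d \<Longrightarrow> A j = (\<Sum>s<r. \<Prod>i<k. x s i (j i))"
    unfolding has_rank_le_def by blast
  have "A = (\<lambda>j\<in>multi_index k d. \<Sum>s<r. outer_product k d (x s) j)"
  proof
    fix j
    show "A j = (\<lambda>j\<in>multi_index k d. \<Sum>s<r. outer_product k d (x s) j) j"
    proof (cases "j \<in> multi_index k d")
      case True
      then show ?thesis
        by (simp add: x outer_product_def)
    next
      case False
      then show ?thesis
        using PiE_arb[OF assms[unfolded arrays_def]] by simp
    qed
  qed
  then show "\<exists>T. (\<forall>s<r. decomposable k d (T s)) \<and> A = (\<lambda>j\<in>multi_index k d. \<Sum>s<r. T s j)"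
    unfolding decomposable_def by (intro exI[of _ "\<lambda>s. outer_product k d (x s)"]) blast
qed

text \<open>Without some admissible number of summands, \<open>LEAST\<close> would be unspecified.
  One summand per entry of the array suffices.\<close>

lemma has_rank_le_exists:
  assumes "k \<ge> 1"
  shows "\<exists>r. has_rank_le k d r A"
proof -
  obtain e where e: "bij_betw e {..<card (multi_index k d)} (multi_index k d)"
    using ex_bij_betw_nat_finite[OF finite_multi_index] lessThan_atLeast0 by metis
  \<comment> \<open>Summand \<open>s\<close> is supported at the single multi-index
    \<open>e s\<close>: unit vectors, with the entry of \<open>A\<close> absorbed into factor 0,
    which exists because \<open>k \<ge> 1\<close>.\<close>
  define x where "x = (\<lambda>s i l. if l = e s i then (if i = 0 then A (e s) else 1) else (0 :: real))"
  have x: "(\<Prod>i<k. x s i (j i)) = (if j = e s then A j else 0)"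
    if j: "j \<in> multi_index k d" and s: "s < card (multi_index k d)" for s j
  proof (cases "j = e s")
    case True
    have "(\<Prod>i<k. x s i (j i)) = (\<Prod>i<k. if i = 0 then A j else 1)"
      by (simp add: x_def True)
    also have "\<dots> = A j"
      using assms by (simp add: prod.delta)
    finally show ?thesis
      using True by simp
  next
    case False
    have "e s \<in> multi_index k d"
      using e s by (auto simp: bij_betw_def)
    then obtain i where "i < k" "j i \<noteq> e s i"
      using j False PiE_ext[of j "{..<k}" "\<lambda>i. {..<d i}" "e s"] unfolding multi_index_def by blast
    then have "\<exists>i\<in>{..<k}. x s i (j i) = 0"
      by (intro bexI[of _ i]) (simp_all add: x_def)
    then show ?thesis
      using False by (simp add: prod_zero_iff)
  qed
  have "A j = (\<Sum>s<card (multi_index k d). \<Prod>i<k. x s i (j i))" if j: "j \<in> multi_index k d" for j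
  proof -
    have "j \<in> e ` {..<card (multi_index k d)}"
      using j bij_betw_imp_surj_on[OF e] by simp
    then obtain s where s: "s < card (multi_index k d)" "e s = j"
      by auto
    have "e s' = j \<longleftrightarrow> s' = s" if "s' < card (multi_index k d)" for s'
      using inj_on_eq_iff[OF bij_betw_imp_inj_on[OF e], of s' s] s that by auto
    then have "(\<Prod>i<k. x s' i (j i)) = (if s' = s then A j else 0)"
      if "s' < card (multi_index k d)" for s'
      using x[OF j that] that by (auto simp: eq_commute[of j])
    then show ?thesis
      using s by simp
  qed
  then show ?thesis
    unfolding has_rank_le_def by blast
qed

lemma outer_rank_eq_iff:
  assumes "k \<ge> 1" "A \<in> arrays k d"
  shows "outer_rank k d A = r \<longleftrightarrow> has_rank_le k d r A \<and> (\<forall>s<r. \<not> has_rank_le k d s A)"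
proof -
  have "outer_rank k d A = (LEAST r. has_rank_le k d r A)"
    unfolding outer_rank_def has_rank_le_iff[OF assms(2)] ..
  then show ?thesis
    using has_rank_le_exists[OF assms(1), of d A] LeastI_ex not_less_Least Least_equality
    by (metis (no_types, lifting) not_le)
qed

text \<open>\<open>Inl j\<close> is an entry of the array and \<open>Inr (s, i, l)\<close> an entry
  of a vector. \<open>W\<close> is the algebraic set of arrays with a given decomposition, and the
  vector coordinates are projected away.\<close>

lemma definable_rank_le:
  "\<exists>S. definable (Inl ` multi_index k d) S \<and>
    (\<forall>A. case_sum A (\<lambda>_ :: nat \<times> nat \<times> nat. 0) \<in> S \<longleftrightarrow> has_rank_le k d r A)"
proof -
  let ?M = "multi_index k d"
  define V where "V = {..<r} \<times> (SIGMA i:{..<k}. {..<d i})"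
  define rhs where "rhs = (\<lambda>j (a :: (nat \<Rightarrow> nat) + nat \<times> nat \<times> nat \<Rightarrow> real).
    \<Sum>s<r. \<Prod>i<k. a (Inr (s, i, j i)))"
  define W where "W = (\<Inter>j\<in>?M. {a. a (Inl j) - rhs j a = 0})"
  have V: "(s, i, j i) \<in> V" if "j \<in> ?M" "s < r" "i < k" for s i j
    using that by (auto simp: V_def multi_index_def PiE_iff)
  have "rhs j \<in> polyfun (Inr ` V \<union> Inl ` ?M)" if "j \<in> ?M" for j
    unfolding rhs_def using V[OF that] by (intro polyfun_sum polyfun_prod polyfun_var) auto
  then have "definable (Inr ` V \<union> Inl ` ?M) W"
    unfolding W_def using finite_multi_index
    by (intro definable_INT definable_zero polyfun_diff polyfun_var) auto
  then have "definable (Inl ` ?M) {a. \<exists>b\<in>W. \<forall>i. i \<notin> Inr ` V \<longrightarrow> b i = a i}"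
    by (intro definable_projections) (auto simp: V_def)
  moreover have "case_sum A (\<lambda>_. 0) \<in> {a. \<exists>b\<in>W. \<forall>i. i \<notin> Inr ` V \<longrightarrow> b i = a i} \<longleftrightarrow>
      has_rank_le k d r A" for A
  proof
    assume "case_sum A (\<lambda>_. 0) \<in> {a. \<exists>b\<in>W. \<forall>i. i \<notin> Inr ` V \<longrightarrow> b i = a i}"
    then obtain b where b: "b \<in> W" "\<And>i. i \<notin> Inr ` V \<Longrightarrow> b i = case_sum A (\<lambda>_. 0) i"
      by blast
    have "A j = rhs j b" if "j \<in> ?M" for j
    proof -
      have "b (Inl j) = A j"
        using b(2)[of "Inl j"] by auto
      then show ?thesis
        using b(1) that by (simp add: W_def)
    qed
    then show "has_rank_le k d r A"
      unfolding has_rank_le_def rhs_def by (intro exI[of _ "\<lambda>s i l. b (Inr (s, i, l))"]) blast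
  next
    assume "has_rank_le k d r A"
    then obtain x where x: "\<And>j. j \<in> ?M \<Longrightarrow> A j = (\<Sum>s<r. \<Prod>i<k. x s i (j i))"
      unfolding has_rank_le_def by blast
    \<comment> \<open>Off \<open>V\<close> the assignment has to keep the filler value 0; the
      vectors may be inserted only on the projected coordinates.\<close>
    define b where "b = case_sum A (\<lambda>v. if v \<in> V then case v of (s, i, l) \<Rightarrow> x s i l else 0)"
    have "rhs j b = A j" if "j \<in> ?M" for j
      using V[OF that] by (simp add: x[OF that] rhs_def b_def)
    then have "b \<in> W"
      by (simp add: W_def b_def)
    moreover have "b i = case_sum A (\<lambda>_. 0) i" if "i \<notin> Inr ` V" for i
      using that by (cases i) (auto simp: b_def)
    ultimately show "case_sum A (\<lambda>_. 0) \<in> {a. \<exists>b\<in>W. \<forall>i. i \<notin> Inr ` V \<longrightarrow> b i = a i}"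
      by blast
  qed
  ultimately show ?thesis
    by blast
qed

theorem theorem6p2:
  fixes k r :: nat and d :: "nat \<Rightarrow> nat"
  assumes "k \<ge> 1" and "\<And>i. i < k \<Longrightarrow> d i \<ge> 1"
  shows "semialgebraic (multi_index k d) {A \<in> arrays k d. outer_rank k d A = r}"
proof -
  have "\<forall>s. \<exists>S. definable (Inl ` multi_index k d) S \<and>
      (\<forall>A. case_sum A (\<lambda>_ :: nat \<times> nat \<times> nat. 0) \<in> S \<longleftrightarrow> has_rank_le k d s A)"
    using definable_rank_le by blast
  then obtain S where S: "\<And>s. definable (Inl ` multi_index k d) (S s)"
      "\<And>s A. case_sum A (\<lambda>_ :: nat \<times> nat \<times> nat. 0) \<in> S s \<longleftrightarrow> has_rank_le k d s A"
    by metis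
  \<comment> \<open>Exact rank is a Boolean combination of the projections for \<open>r\<close> and
    all smaller numbers, so negation is applied only after the vectors have been eliminated.\<close>
  have "definable (Inl ` multi_index k d) (S r \<inter> (\<Inter>s\<in>{..<r}. - S s))"
    by (intro definable_Int definable_INT definable_Compl S) auto
  then have "semialgebraic (multi_index k d)
      {A \<in> multi_index k d \<rightarrow>\<^sub>E UNIV. case_sum A (\<lambda>_. 0) \<in> S r \<inter> (\<Inter>s\<in>{..<r}. - S s)}"
    using definable_Inl by blast
  also have "{A \<in> multi_index k d \<rightarrow>\<^sub>E UNIV. case_sum A (\<lambda>_. 0) \<in> S r \<inter> (\<Inter>s\<in>{..<r}. - S s)} =
      {A \<in> arrays k d. outer_rank k d A = r}"
    using outer_rank_eq_iff[OF assms(1)] by (auto simp: S(2) arrays_def)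
  finally show ?thesis .
qed

end
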